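(* Let $S=\{0=s_0<s_1<\dots<s_n\}$ be a compact distance set with block decomposition $S=\{0\}\cup B_1\cup\dots\cup B_k$, $k\ge2$, and let $S^+=S\setminus B_1$. Then for every finite $S$-metric space $\mathcal{M}$ and every finite $S^+$-metric space $\mathcal{L}$ which spans $\mathcal{M}$, $\mathcal{M}$ has finite big Ramsey degree in $\mathcal{U}_{S,\mathcal{L}}$.
   Context: For $S=\{0=s_0<\dots<s_n\}$, $s_i$ is a jump number if $i=n$ or $2s_i<s_{i+1}$; for consecutive jump numbers $s_i<s_j$, $S\cap(s_i,s_j]$ is a block, and $\{0\}$ is the trivial block; blocks are enumerated $\{0\},B_1,\dots,B_k$ increasingly. $x\approx y$ iff $x,y$ are in the same block. $S$ is a compact distance set if for all $x,y\in S\setminus\{0\}$: $|x-y|\le s_1$ iff $x\approx y$. $\mathbf{Met}_S$ is the class of finite and countably infinite metric spaces with distances in $S$, with isometric embeddings as morphisms. For $\mathcal{M}=(M,d)\in\mathbf{Met}_S$, $x\sim y$ iff $d(x,y)\in\{0\}\cup B_1$. A finite $S^+$-metric space $\mathcal{L}$ spans $\mathcal{M}$ if $|M/{\sim}|=|L|$ and the partition $M/{\sim}=\{A_1,\dots,A_m\}$ has a transversal $a_i\in A_i$ whose subspace is isometric to $\mathcal{L}$. $\mathbf{Met}_{S,\mathcal{L}}$ is the full subcategory of $\mathbf{Met}_S$ of spaces spanned by $\mathcal{L}$. $\mathcal{U}_{S,\mathcal{L}}$ is the Fraïssé limit of the finite members of $\mathbf{Met}_{S,\mathcal{L}}$ with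 respect to $\mathbf{Met}_{S,\mathcal{L}}$: the unique (up to isometry) countably infinite space in $\mathbf{Met}_{S,\mathcal{L}}$ which is ultrahomogeneous (for every finite $\mathcal{A}\in\mathbf{Met}_{S,\mathcal{L}}$, any two isometric embeddings $f,g:\mathcal{A}\hookrightarrow\mathcal{U}_{S,\mathcal{L}}$ satisfy $f=h\circ g$ for some isometry $h$ of $\mathcal{U}_{S,\mathcal{L}}$) and whose finite members of $\mathbf{Met}_{S,\mathcal{L}}$ embeddable into it are exactly all finite members of $\mathbf{Met}_{S,\mathcal{L}}$ (this exists since that class is a Fraïssé age). $\mathcal{M}$ has finite big Ramsey degree in $\mathcal{U}_{S,\mathcal{L}}$ if there is a positive integer $t$ such that for every $k\ge2$ and every $k$-coloring of the isometric embeddings $\mathcal{M}\hookrightarrow\mathcal{U}_{S,\mathcal{L}}$ there is an isometric embedding $w:\mathcal{U}_{S,\mathcal{L}}\hookrightarrow\mathcal{U}_{S,\mathcal{L}}$ such that the embeddings $w\circ f$ receive at most $t$ colors. *)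

theory Defs
  imports "HOL-Analysis.Analysis"
begin

section \<open>Distance sets and their blocks\<close>

definition distance_set :: "real set \<Rightarrow> bool" where
  "distance_set S \<longleftrightarrow> finite S \<and> 0 \<in> S \<and> (\<forall>x\<in>S. 0 \<le> x)"

text \<open>For \<open>x = s\<^sub>i\<close> the successor \<open>s\<^sub>i\<^sub>+\<^sub>1\<close> is the minimum of the elements of \<open>S\<close> above \<open>x\<close>;
  the disjunct \<open>x = Max S\<close> is the case \<open>i = n\<close>.\<close>

definition jump_numbers :: "real set \<Rightarrow> real set" where
  "jump_numbers S = {x \<in> S. x = Max S \<or> 2 * x < Min {y \<in> S. x < y}}"

text \<open>The \<open>i\<close>-th jump number in increasing order, counting from 0; only meaningful for
  \<open>i < card (jump_numbers S)\<close>. As 0 is always a jump number of a distance set, it is the jump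
  number of index 0.\<close>

definition jump :: "real set \<Rightarrow> nat \<Rightarrow> real" where
  "jump S i = sorted_list_of_set (jump_numbers S) ! i"

definition num_blocks :: "real set \<Rightarrow> nat" where
  "num_blocks S = card (jump_numbers S) - 1"

text \<open>\<open>block S 0\<close> is the trivial block, and \<open>block S i\<close> for \<open>1 \<le> i \<le> num_blocks S\<close> is \<open>B\<^sub>i\<close>.\<close>

definition block :: "real set \<Rightarrow> nat \<Rightarrow> real set" where
  "block S i = (if i = 0 then {0} else S \<inter> {jump S (i - 1)<..jump S i})"

definition same_block :: "real set \<Rightarrow> real \<Rightarrow> real \<Rightarrow> bool" where
  "same_block S x y \<longleftrightarrow> (\<exists>i\<le>num_blocks S. x \<in> block S i \<and> y \<in> block S i)"

definition compact_distance_set :: "real set \<Rightarrow> bool" where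
  "compact_distance_set S \<longleftrightarrow> distance_set S \<and>
     (\<forall>x\<in>S - {0}. \<forall>y\<in>S - {0}. \<bar>x - y\<bar> \<le> Min (S - {0}) \<longleftrightarrow> same_block S x y)"


section \<open>Metric spaces with distances in \<open>S\<close>\<close>

definition Met :: "real set \<Rightarrow> 'a metric set" where
  "Met S = {M. countable (mspace M) \<and> (\<forall>x\<in>mspace M. \<forall>y\<in>mspace M. mdist M x y \<in> S)}"

text \<open>Embeddings are extensional functions, so that two of them are equal as soon as they agree on
  the domain; correspondingly they are composed with \<^const>\<open>compose\<close>.\<close>

definition embeddings :: "'a metric \<Rightarrow> 'b metric \<Rightarrow> ('a \<Rightarrow> 'b) set" where
  "embeddings M N = {f \<in> mspace M \<rightarrow>\<^sub>E mspace N.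
     \<forall>x\<in>mspace M. \<forall>y\<in>mspace M. mdist N (f x) (f y) = mdist M x y}"

definition isometries :: "'a metric \<Rightarrow> 'b metric \<Rightarrow> ('a \<Rightarrow> 'b) set" where
  "isometries M N = {f \<in> embeddings M N. bij_betw f (mspace M) (mspace N)}"

definition isometric :: "'a metric \<Rightarrow> 'b metric \<Rightarrow> bool" where
  "isometric M N \<longleftrightarrow> isometries M N \<noteq> {}"

definition near :: "real set \<Rightarrow> 'a metric \<Rightarrow> ('a \<times> 'a) set" where
  "near S M = {(x, y). x \<in> mspace M \<and> y \<in> mspace M \<and> mdist M x y \<in> {0} \<union> block S 1}"

definition spans :: "real set \<Rightarrow> 'b metric \<Rightarrow> 'a metric \<Rightarrow> bool" where
  "spans S L M \<longleftrightarrow>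
     finite (mspace M // near S M) \<and> card (mspace M // near S M) = card (mspace L) \<and>
     (\<exists>T\<subseteq>mspace M. (\<forall>A\<in>mspace M // near S M. \<exists>!a. a \<in> T \<inter> A) \<and>
        isometric (submetric M T) L)"

definition Met_spanned :: "real set \<Rightarrow> 'b metric \<Rightarrow> 'a metric set" where
  "Met_spanned S L = {M \<in> Met S. spans S L M}"


section \<open>The limit space and big Ramsey degrees\<close>

text \<open>Every finite metric space is isometric to one whose points are natural numbers, so it is
  enough to let the finite members of the class range over type \<^typ>\<open>nat metric\<close>.\<close>

definition fin_Met_spanned :: "real set \<Rightarrow> 'b metric \<Rightarrow> nat metric set" where
  "fin_Met_spanned S L = {A \<in> Met_spanned S L. finite (mspace A)}"

definition age :: "real set \<Rightarrow> 'b metric \<Rightarrow> 'c metric \<Rightarrow> nat metric set" where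
  "age S L U = {A \<in> fin_Met_spanned S L. embeddings A U \<noteq> {}}"

definition ultrahomogeneous :: "real set \<Rightarrow> 'b metric \<Rightarrow> 'c metric \<Rightarrow> bool" where
  "ultrahomogeneous S L U \<longleftrightarrow>
     (\<forall>A\<in>fin_Met_spanned S L. \<forall>f\<in>embeddings A U. \<forall>g\<in>embeddings A U.
        \<exists>h\<in>isometries U U. f = compose (mspace A) h g)"

text \<open>The limit is unique only up to isometry, hence a predicate: it characterizes the spaces that
  are a copy of \<open>\<U>\<^bsub>S,L\<^esub>\<close>.\<close>

definition fraisse_limit :: "real set \<Rightarrow> 'b metric \<Rightarrow> 'c metric \<Rightarrow> bool" where
  "fraisse_limit S L U \<longleftrightarrow>
     U \<in> Met_spanned S L \<and> infinite (mspace U) \<and>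
     ultrahomogeneous S L U \<and> age S L U = fin_Met_spanned S L"

definition finite_big_ramsey_degree :: "'a metric \<Rightarrow> 'c metric \<Rightarrow> bool" where
  "finite_big_ramsey_degree M U \<longleftrightarrow>
     (\<exists>t::nat. 0 < t \<and>
        (\<forall>k\<ge>2. \<forall>c :: ('a \<Rightarrow> 'c) \<Rightarrow> nat. c \<in> embeddings M U \<rightarrow> {..<k} \<longrightarrow>
           (\<exists>w\<in>embeddings U U.
              card ((\<lambda>f. c (compose (mspace M) w f)) ` embeddings M U) \<le> t)))"

end

theory Submission
  imports Defs
begin

text \<open>
  In a compact distance set the validity of a triangle depends only on the blocks of its sides.
  Hence a space spanned by \<open>L\<close> amounts to a complete graph on finitely many classes, with edges
  coloured freely by the distances in the block attached to each pair of classes, and the limit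
  realizes every one-point extension of its finite subspaces. Coding a point by its class and the
  word of its distances to the points enumerated before it embeds the limit into a structure on
  words over a finite alphabet, which in turn embeds into the limit. The distances in that
  structure are letters read at the length of the shorter word, so they are preserved by
  substitution into a word with infinitely many parameters. A family of \<open>p\<close> words over \<open>r\<close> letters is an
  instance of one word with at most \<open>(r + 1) ^ p\<close> letters and parameters, obtained by naming its
  columns. The Carlson--Simpson theorem then leaves as many colours as there are
  instantiation patterns, a number independent of the colouring.
\<close>

section \<open>Compact right topological semigroups\<close>

text \<open>Truncation is what makes substitution isometric. For rigid \<open>W\<close> a word of
  length \<open>l\<close> is cut at \<open>first_occ W l\<close>, and at exactly that position every
  longer word shows its own letter number \<open>l\<close>. So the letter recording a distance
  survives, and every rigid \<open>W\<close> yields an embedding of the limit into itself; the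
  colouring argument only has to choose \<open>W\<close>. A copy of \<open>M\<close> is a family of
  words, whereas the Carlson-Simpson theorem colours single words. Naming columns bridges the gap:
  the family is given by one word \<open>a\<close> and a pattern of bounded size. Instances are cut
  at the first letter the pattern does not supply, so reparametrizing \<open>a\<close>
  reparametrizes all members at once. A colouring of \<open>a\<close> that records the colours for
  all patterns then leaves one colour per pattern. Constants and parameters are treated alike: words
  start with \<open>[0..<r]\<close>, so constants are merely the first \<open>r\<close> letters,
  kept in place in the Ramsey theorem by \<open>W i = i\<close> below \<open>r\<close>. This lets a
  fusion step declare further letters to be constants.\<close>

lemma compact_imp_closed_fun:
  fixes X :: "('a \<Rightarrow> 'b::t2_space) set"
  assumes "compact X"
  shows "closed X"
proof -
  have "Hausdorff_space (euclidean :: 'b topology)"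
    unfolding Hausdorff_space_def disjnt_def using hausdorff by (metis open_openin)
  then have "Hausdorff_space (euclidean :: ('a \<Rightarrow> 'b) topology)"
    unfolding euclidean_product_topology[symmetric]
    by (simp add: Hausdorff_space_product_topology)
  then show ?thesis
    using assms compactin_imp_closedin by fastforce
qed

lemma compact_UNIV_fun_bool: "compact (UNIV :: ('a \<Rightarrow> bool) set)"
proof -
  have "compact (UNIV :: bool set)"
    by (simp add: finite_imp_compact)
  then have "compact_space (product_topology (\<lambda>i::'a. euclidean :: bool topology) UNIV)"
    unfolding compact_space_product_topology by (simp add: compact_space_def)
  then have "compact_space (euclidean :: ('a \<Rightarrow> bool) topology)"
    by (simp only: euclidean_product_topology)
  then show ?thesis
    by (simp add: compact_space_def)
qed

text \<open>Zorn's lemma for reverse inclusion. Compactness makes the intersection of a chain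
  nonempty, so \<open>chain\<close> leaves only algebraic closure conditions to be checked;
  \<open>closed\<close> stands in for the Hausdorff property.\<close>

lemma minimal_compact_set:
  fixes \<F> :: "'a::topological_space set set"
  assumes ne: "K \<in> \<F>" and closed: "\<And>X :: 'a set. compact X \<Longrightarrow> closed X"
    and comp: "\<And>X. X \<in> \<F> \<Longrightarrow> compact X \<and> X \<noteq> {}"
    and chain: "\<And>C. \<lbrakk>C \<noteq> {}; C \<subseteq> \<F>; compact (\<Inter>C); \<Inter>C \<noteq> {}\<rbrakk> \<Longrightarrow> \<Inter>C \<in> \<F>"
  obtains X where "X \<in> \<F>" "\<And>Y. Y \<in> \<F> \<Longrightarrow> Y \<subseteq> X \<Longrightarrow> Y = X"
proof -
  have "\<exists>X\<in>\<F>. \<forall>Y\<in>\<F>. X \<supseteq> Y \<longrightarrow> Y = X"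
  proof (rule predicate_Zorn)
    show "partial_order_on \<F> (relation_of (\<supseteq>) \<F>)"
      by (auto simp: partial_order_on_def preorder_on_def refl_on_def trans_def antisym_def relation_of_def)
    fix C assume "C \<in> Chains (relation_of (\<supseteq>) \<F>)"
    then have C: "C \<subseteq> \<F>" "\<And>X Y. X \<in> C \<Longrightarrow> Y \<in> C \<Longrightarrow> X \<subseteq> Y \<or> Y \<subseteq> X"
      by (auto simp: Chains_def relation_of_def)
    show "\<exists>u\<in>\<F>. \<forall>a\<in>C. u \<subseteq> a"
    proof (cases "C = {}")
      case True then show ?thesis using ne by auto
    next
      case False
      then obtain X0 where X0: "X0 \<in> C" by auto
      have cl: "closed X" if "X \<in> C" for X
        using comp C that by (auto intro: closed)
      have fin: "\<exists>Z\<in>C. Z \<subseteq> \<Inter>B" if "finite B" "B \<subseteq> C" for B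
        using that
      proof (induction B)
        case empty then show ?case using X0 by auto
      next
        case (insert x B)
        then obtain Z where "Z \<in> C" "Z \<subseteq> \<Inter>B" by auto
        moreover have "x \<in> C" using insert.prems by simp
        ultimately show ?case using C(2)[of Z x]
          by (cases "Z \<subseteq> x") (blast intro: bexI[of _ Z] bexI[of _ x])+
      qed
      have "X0 \<inter> \<Inter>C \<noteq> {}"
      proof (rule compact_imp_fip)
        show "compact X0" using comp C X0 by auto
        show "closed T" if "T \<in> C" for T using cl that .
        show "X0 \<inter> \<Inter>B \<noteq> {}" if "finite B" "B \<subseteq> C" for B
        proof -
          obtain Z where "Z \<in> C" "Z \<subseteq> X0 \<inter> \<Inter>B"
            using fin[of "insert X0 B"] \<open>finite B\<close> \<open>B \<subseteq> C\<close> X0 by auto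
          moreover have "Z \<noteq> {}" using \<open>Z \<in> C\<close> comp C(1) by blast
          ultimately show ?thesis by blast
        qed
      qed
      then have ne': "\<Inter>C \<noteq> {}" by auto
      have "\<Inter>C = X0 \<inter> \<Inter>C" using X0 by auto
      also have "compact \<dots>"
        using comp C X0 cl by (intro compact_Int_closed closed_Inter) auto
      finally have "\<Inter>C \<in> \<F>" using chain False C ne' by blast
      then show ?thesis by auto
    qed
  qed
  then show ?thesis using that by blast
qed

text \<open>In a minimal compact subsemigroup \<open>X\<close> the subset \<open>X e\<close> must be
  all of \<open>X\<close>. So the elements \<open>x\<close> with \<open>x e = e\<close> form a
  nonempty compact subsemigroup, again all of \<open>X\<close>, and \<open>e\<close> is one of
  them.\<close>

lemma ellis_idempotent:
  fixes m :: "'a::topological_space \<Rightarrow> 'a \<Rightarrow> 'a"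
  assumes closed: "\<And>X :: 'a set. compact X \<Longrightarrow> closed X" and K: "compact K" "K \<noteq> {}" and mK: "\<And>x y. x \<in> K \<Longrightarrow> y \<in> K \<Longrightarrow> m x y \<in> K"
    and assoc: "\<And>x y z. m (m x y) z = m x (m y z)"
    and cont: "\<And>y. continuous_on UNIV (\<lambda>x. m x y)"
  obtains e where "e \<in> K" "m e e = e"
proof -
  define \<F> where "\<F> = {X. X \<subseteq> K \<and> compact X \<and> X \<noteq> {} \<and> (\<forall>x\<in>X. \<forall>y\<in>X. m x y \<in> X)}"
  obtain X where X: "X \<in> \<F>" and min: "\<And>Y. Y \<in> \<F> \<Longrightarrow> Y \<subseteq> X \<Longrightarrow> Y = X"
  proof (rule minimal_compact_set[of K \<F>])
    show "K \<in> \<F>" using K mK by (auto simp: \<F>_def)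
  next
    fix C assume "C \<noteq> {}" "C \<subseteq> \<F>" "compact (\<Inter>C)" "\<Inter>C \<noteq> {}"
    then show "\<Inter>C \<in> \<F>"
      unfolding \<F>_def by (auto simp: subset_iff)
  qed (auto simp: \<F>_def closed)
  from X obtain e where e: "e \<in> X" by (auto simp: \<F>_def)
  have Xm: "m x y \<in> X" if "x \<in> X" "y \<in> X" for x y using X that by (auto simp: \<F>_def)
  have XK: "X \<subseteq> K" "compact X" using X by (auto simp: \<F>_def)
  have "(\<lambda>x. m x e) ` X \<in> \<F>"
  proof -
    have "compact ((\<lambda>x. m x e) ` X)"
      by (intro compact_continuous_image continuous_on_subset[OF cont] XK) auto
    moreover have "m x e \<in> K" if "x \<in> X" for x using Xm e XK that by auto
    ultimately show ?thesis
      unfolding \<F>_def using e Xm by (auto simp: assoc[symmetric])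
  qed
  then have "(\<lambda>x. m x e) ` X = X" using Xm e by (intro min) auto
  then obtain y where y: "y \<in> X" "m y e = e" using e by (metis imageE)
  define Y where "Y = X \<inter> (\<lambda>x. m x e) -` {e}"
  have "closed ((\<lambda>x. m x e) -` {e})"
    by (rule closed_vimage) (auto simp: cont closed)
  then have "Y \<in> \<F>"
    unfolding \<F>_def Y_def using XK Xm y by (auto simp: assoc intro: compact_Int_closed)
  then have "Y = X" by (rule min) (auto simp: Y_def)
  then have "m e e = e" using e by (auto simp: Y_def)
  then show ?thesis using that e XK by auto
qed

text \<open>If \<open>f\<close> is an idempotent of the minimal left ideal \<open>X\<close>, then
  \<open>K f\<close> is a compact left ideal inside \<open>X\<close>, hence equals \<open>X\<close>.
  So each \<open>e\<close> in \<open>X\<close> has the form \<open>z f\<close>, and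
  \<open>e f = z f f = e\<close>.\<close>

lemma minimal_left_ideal:
  fixes m :: "'a::topological_space \<Rightarrow> 'a \<Rightarrow> 'a"
  assumes closed: "\<And>X :: 'a set. compact X \<Longrightarrow> closed X" and K: "compact K" "K \<noteq> {}" and mK: "\<And>x y. x \<in> K \<Longrightarrow> y \<in> K \<Longrightarrow> m x y \<in> K"
    and assoc: "\<And>x y z. m (m x y) z = m x (m y z)"
    and cont: "\<And>y. continuous_on UNIV (\<lambda>x. m x y)"
  obtains I where "I \<subseteq> K" "compact I" "I \<noteq> {}" "\<And>x y. x \<in> K \<Longrightarrow> y \<in> I \<Longrightarrow> m x y \<in> I"
    "\<And>e f. e \<in> I \<Longrightarrow> f \<in> I \<Longrightarrow> m f f = f \<Longrightarrow> m e f = e"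
proof -
  define \<F> where "\<F> = {X. X \<subseteq> K \<and> compact X \<and> X \<noteq> {} \<and> (\<forall>x\<in>K. \<forall>y\<in>X. m x y \<in> X)}"
  obtain X where X: "X \<in> \<F>" and min: "\<And>Y. Y \<in> \<F> \<Longrightarrow> Y \<subseteq> X \<Longrightarrow> Y = X"
  proof (rule minimal_compact_set[of K \<F>])
    show "K \<in> \<F>" using K mK by (auto simp: \<F>_def)
  next
    fix C assume "C \<noteq> {}" "C \<subseteq> \<F>" "compact (\<Inter>C)" "\<Inter>C \<noteq> {}"
    then show "\<Inter>C \<in> \<F>"
      unfolding \<F>_def by (auto simp: subset_iff)
  qed (auto simp: \<F>_def closed)
  have X': "X \<subseteq> K" "compact X" "X \<noteq> {}" "\<And>x y. x \<in> K \<Longrightarrow> y \<in> X \<Longrightarrow> m x y \<in> X"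
    using X by (auto simp: \<F>_def)
  have "m e f = e" if "e \<in> X" "f \<in> X" "m f f = f" for e f
  proof -
    have "(\<lambda>x. m x f) ` K \<in> \<F>"
    proof -
      have "compact ((\<lambda>x. m x f) ` K)"
        by (intro compact_continuous_image continuous_on_subset[OF cont] K) auto
      then show ?thesis
        unfolding \<F>_def using X'(1) K(2) mK \<open>f \<in> X\<close> by (auto simp: assoc[symmetric])
    qed
    then have "(\<lambda>x. m x f) ` K = X" using X' \<open>f \<in> X\<close> by (intro min) auto
    then obtain z where "e = m z f" using \<open>e \<in> X\<close> by auto
    then show ?thesis using that by (simp add: assoc)
  qed
  with X' show ?thesis by (rule that)
qed

section \<open>Ultrafilters on words\<close>

text \<open>Ultrafilters are kept as predicates on sets so that they are points of a power of
  \<open>bool\<close>, whose product topology is compact.\<close>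

definition ultra :: "('a set \<Rightarrow> bool) \<Rightarrow> bool" where
  "ultra u \<longleftrightarrow> u UNIV \<and> (\<forall>A B. u (A \<inter> B) \<longleftrightarrow> u A \<and> u B) \<and> (\<forall>A. u (- A) \<longleftrightarrow> \<not> u A)"

text \<open>The extension of concatenation to ultrafilters. With \<open>u\<close> as the outer
  quantifier, each value of the result is a coordinate of \<open>u\<close>, whence continuity in the
  left factor.\<close>

definition ultra_cat :: "('a list set \<Rightarrow> bool) \<Rightarrow> ('a list set \<Rightarrow> bool) \<Rightarrow> 'a list set \<Rightarrow> bool" where
  "ultra_cat u v P = u {x. v {y. x @ y \<in> P}}"

definition ultra_map :: "('a \<Rightarrow> 'b) \<Rightarrow> ('a set \<Rightarrow> bool) \<Rightarrow> 'b set \<Rightarrow> bool" where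
  "ultra_map h u P = u (h -` P)"

lemma ultra_Int: "ultra u \<Longrightarrow> u (A \<inter> B) \<longleftrightarrow> u A \<and> u B"
  and ultra_Compl: "ultra u \<Longrightarrow> u (- A) \<longleftrightarrow> \<not> u A"
  and ultra_UNIV: "ultra u \<Longrightarrow> u UNIV"
  by (simp_all add: ultra_def)

lemma ultra_mono: "ultra u \<Longrightarrow> u A \<Longrightarrow> A \<subseteq> B \<Longrightarrow> u B"
  using ultra_Int[of u A B] by (simp add: Int_absorb2)

lemma ultra_empty: "ultra u \<Longrightarrow> \<not> u {}"
  using ultra_Compl[of u UNIV] ultra_UNIV[of u] by simp

lemma ultra_INT:
  assumes "ultra u" "finite I" "\<And>i. i \<in> I \<Longrightarrow> u (A i)"
  shows "u (\<Inter>i\<in>I. A i)"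
  using assms(2,3) by (induction I) (auto simp: ultra_Int ultra_UNIV assms(1))

lemma ultra_colour:
  assumes "ultra u" "finite (range \<kappa>)"
  obtains c where "u {x. \<kappa> x = c}"
proof (rule ccontr)
  assume "\<not> thesis"
  with that have no: "\<not> u {x. \<kappa> x = c}" for c by blast
  have "u (\<Inter>c\<in>range \<kappa>. - {x. \<kappa> x = c})"
    by (rule ultra_INT[OF assms]) (use assms no in \<open>simp add: ultra_Compl\<close>)
  moreover have "(\<Inter>c\<in>range \<kappa>. - {x. \<kappa> x = c}) = {}" by auto
  ultimately show False using ultra_empty assms(1) by metis
qed

lemma ultra_point: "ultra (\<lambda>P. x \<in> P)"
  by (simp add: ultra_def)

lemma ultra_ultra_cat: "ultra u \<Longrightarrow> ultra v \<Longrightarrow> ultra (ultra_cat u v)"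
proof -
  assume u: "ultra u" and v: "ultra v"
  have "{y. x @ y \<in> A \<inter> B} = {y. x @ y \<in> A} \<inter> {y. x @ y \<in> B}"
    "{y. x @ y \<in> - A} = - {y. x @ y \<in> A}" for x and A B :: "'a list set" by auto
  moreover have "{x. v {y. x @ y \<in> A} \<and> v {y. x @ y \<in> B}} = {x. v {y. x @ y \<in> A}} \<inter> {x. v {y. x @ y \<in> B}}"
    "{x. \<not> v {y. x @ y \<in> A}} = - {x. v {y. x @ y \<in> A}}" for A B by auto
  ultimately show "ultra (ultra_cat u v)"
    using u v unfolding ultra_def[of "ultra_cat u v"] ultra_cat_def
    by (simp add: ultra_Int ultra_Compl ultra_UNIV)
qed

lemma ultra_cat_assoc: "ultra_cat (ultra_cat u v) w = ultra_cat u (ultra_cat v w)"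
  by (auto simp: ultra_cat_def)

lemma ultra_map_cat:
  assumes "\<And>x y. h (x @ y) = h x @ h y"
  shows "ultra_map h (ultra_cat u v) = ultra_cat (ultra_map h u) (ultra_map h v)"
  by (auto simp: ultra_cat_def ultra_map_def vimage_def assms)

lemma continuous_on_ultra_cat: "continuous_on A (\<lambda>u. ultra_cat u v)"
  unfolding ultra_cat_def
  by (rule continuous_on_coordinatewise_then_product)
    (rule continuous_on_subset[OF continuous_on_product_coordinates subset_UNIV])

lemma continuous_on_ultra_map: "continuous_on A (ultra_map h)"
  unfolding ultra_map_def[abs_def]
  by (rule continuous_on_coordinatewise_then_product)
    (rule continuous_on_subset[OF continuous_on_product_coordinates subset_UNIV])

text \<open>Each axiom in \<open>ultra\<close> constrains at most three coordinates, so the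
  ultrafilters form an intersection of such sets.\<close>

lemma closed_bool_coordinates:
  "closed {u :: 'a \<Rightarrow> bool. Q (u a) (u b) (u c)}"
proof -
  have "closed ((\<lambda>u :: 'a \<Rightarrow> bool. (u a, u b, u c)) -` {(x, y, z). Q x y z})"
    by (intro closed_vimage finite_imp_closed continuous_on_Pair continuous_on_product_coordinates) auto
  then show ?thesis by (simp add: vimage_def)
qed

lemma closed_ultra: "closed {u :: 'a set \<Rightarrow> bool. ultra u}"
proof -
  have "{u :: 'a set \<Rightarrow> bool. ultra u} = {u. u UNIV} \<inter>
    (\<Inter>A. \<Inter>B. {u. u (A \<inter> B) \<longleftrightarrow> u A \<and> u B}) \<inter> (\<Inter>A. {u. u (- A) \<longleftrightarrow> \<not> u A})"
    by (rule set_eqI) (simp add: ultra_def)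
  moreover have "closed {u :: 'a set \<Rightarrow> bool. u UNIV}"
    using closed_bool_coordinates[of "\<lambda>x y z. x" UNIV] .
  moreover have "closed {u :: 'a set \<Rightarrow> bool. u (A \<inter> B) \<longleftrightarrow> u A \<and> u B}" for A B
    using closed_bool_coordinates[of "\<lambda>x y z. x \<longleftrightarrow> y \<and> z" "A \<inter> B" A B] .
  moreover have "closed {u :: 'a set \<Rightarrow> bool. u (- A) \<longleftrightarrow> \<not> u A}" for A
    using closed_bool_coordinates[of "\<lambda>x y z. x \<longleftrightarrow> \<not> y" "- A" A] .
  ultimately show ?thesis
    by (simp only:) (intro closed_Int closed_INT ballI; assumption)
qed

definition ultra_on :: "'a set \<Rightarrow> ('a set \<Rightarrow> bool) set" where
  "ultra_on X = {u. ultra u \<and> u X}"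

lemma compact_ultra_on: "compact (ultra_on X)"
proof -
  have "ultra_on X = UNIV \<inter> ({u. ultra u} \<inter> {u. u X})" by (auto simp: ultra_on_def)
  also have "compact \<dots>"
    using closed_bool_coordinates[of "\<lambda>x y z. x" X]
    by (intro compact_Int_closed compact_UNIV_fun_bool closed_Int closed_ultra) auto
  finally show ?thesis .
qed

lemma ultra_cat_in_ultra_on:
  assumes "u \<in> ultra_on X" "v \<in> ultra_on Y" "\<And>x y. x \<in> X \<Longrightarrow> y \<in> Y \<Longrightarrow> x @ y \<in> Z"
  shows "ultra_cat u v \<in> ultra_on Z"
proof -
  have uv: "ultra u" "u X" "ultra v" "v Y" using assms by (auto simp: ultra_on_def)
  have "v {y. x @ y \<in> Z}" if "x \<in> X" for x
    by (rule ultra_mono[OF uv(3,4)]) (use assms(3) that in auto)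
  then have "u {x. v {y. x @ y \<in> Z}}"
    by (intro ultra_mono[OF uv(1,2)]) auto
  then show ?thesis using assms by (simp add: ultra_on_def ultra_ultra_cat) (simp add: ultra_cat_def)
qed

text \<open>The pigeonhole principle behind the Carlson--Simpson theorem; the letter \<open>n\<close> plays the role
  of the variable. Let \<open>I\<close> be a minimal left ideal in the semigroup of ultrafilters on words. An
  idempotent \<open>r\<close> on the words starting with the variable, all of whose substitution instances
  lie in \<open>I\<close>, exists because these form a compact semigroup. As idempotents of \<open>I\<close> are right
  identities of \<open>I\<close>, the set of \<open>w\<close> in a large colour class \<open>C\<close> with \<open>w v \<in> C\<close> for most
  instances \<open>v\<close> reproduces itself.\<close>

lemma left_variable_words:
  fixes \<kappa> :: "nat list \<Rightarrow> 'x"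
  assumes fin: "finite (range \<kappa>)" and n: "n > 0"
  obtains D c where "D \<noteq> {}" "D \<subseteq> lists {..<n}" "\<And>w. w \<in> D \<Longrightarrow> \<kappa> w = c"
    "\<And>F. finite F \<Longrightarrow> F \<subseteq> D \<Longrightarrow>
      \<exists>z\<in>lists {..n}. \<forall>w\<in>F. \<forall>a<n. w @ a # map (\<lambda>i. if i = n then a else i) z \<in> D"
proof -
  define h where "h a = map (\<lambda>i. if i = n then a else i)" for a :: nat
  have h_app: "h a (x @ y) = h a x @ h a y" for a x y by (simp add: h_def)
  define X where "X = lists {..<n}"
  \<comment> \<open>The leading variable makes each new parameter appear immediately after the word
    built so far, which later fixes where instances are cut.\<close>
  define L where "L = (#) n ` lists {..n}"
  have hX: "h a x = x" if "x \<in> X" for a x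
    using that by (auto simp: h_def X_def intro!: map_idI)
  obtain I where I: "I \<subseteq> ultra_on X" "compact I" "I \<noteq> {}"
    "\<And>u v. u \<in> ultra_on X \<Longrightarrow> v \<in> I \<Longrightarrow> ultra_cat u v \<in> I"
    "\<And>e f. e \<in> I \<Longrightarrow> f \<in> I \<Longrightarrow> ultra_cat f f = f \<Longrightarrow> ultra_cat e f = e"
  proof (rule minimal_left_ideal[of "ultra_on X" ultra_cat])
    have "(\<lambda>P. [] \<in> P) \<in> ultra_on X" by (auto simp: ultra_on_def ultra_point X_def)
    then show "ultra_on X \<noteq> {}" by blast
    show "ultra_cat u v \<in> ultra_on X" if "u \<in> ultra_on X" "v \<in> ultra_on X" for u v
      using that by (rule ultra_cat_in_ultra_on) (auto simp: X_def)
  qed (auto simp: compact_imp_closed_fun compact_ultra_on ultra_cat_assoc continuous_on_ultra_cat)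
  define J where "J = ultra_on L \<inter> (\<Inter>a<n. ultra_map (h a) -` I)"
  obtain r where r: "r \<in> J" "ultra_cat r r = r"
  proof (rule ellis_idempotent[of J ultra_cat])
    show "compact J"
      unfolding J_def using I(2)
      by (intro compact_Int_closed compact_ultra_on closed_INT ballI closed_vimage
          compact_imp_closed_fun continuous_on_ultra_map)
    \<comment> \<open>The witness is the variable followed by \<open>y\<close>. As \<open>y\<close>
      lives on variable-free words, substituting \<open>a\<close> gives \<open>[a]\<close> followed
      by \<open>y\<close>, a member of the left ideal \<open>I\<close>.\<close>
    obtain y where y: "y \<in> I" using I by auto
    then have yX: "y \<in> ultra_on X" using I by auto
    define u where "u = ultra_cat (\<lambda>P. [n] \<in> P) y"
    have "u \<in> ultra_on L"
      unfolding u_def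
    proof (rule ultra_cat_in_ultra_on[of _ "{[n]}" _ X])
      show "x @ y \<in> L" if "x \<in> {[n]}" "y \<in> X" for x y
        using that unfolding L_def X_def by (auto intro!: imageI)
    qed (auto simp: ultra_on_def ultra_point yX[unfolded ultra_on_def, simplified])
    moreover have "ultra_map (h a) u \<in> I" if "a < n" for a
    proof -
      have "ultra_map (h a) y = y"
      proof
        fix P
        have "y (h a -` P \<inter> X) = y (P \<inter> X)"
          using hX by (intro arg_cong[of _ _ y]) auto
        then show "ultra_map (h a) y P = y P"
          using yX by (auto simp: ultra_map_def ultra_on_def ultra_Int)
      qed
      moreover have "ultra_map (h a) (\<lambda>P. [n] \<in> P) = (\<lambda>P. [a] \<in> P)"
        by (auto simp: ultra_map_def h_def)
      ultimately have "ultra_map (h a) u = ultra_cat (\<lambda>P. [a] \<in> P) y"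
        by (simp add: u_def ultra_map_cat h_app)
      also have "\<dots> \<in> I"
        using that y by (intro I(4)) (auto simp: ultra_on_def ultra_point X_def)
      finally show ?thesis .
    qed
    ultimately have "u \<in> J" by (auto simp: J_def)
    then show "J \<noteq> {}" by auto
    fix u v assume uv: "u \<in> J" "v \<in> J"
    have "ultra_cat u v \<in> ultra_on L"
      by (rule ultra_cat_in_ultra_on[of _ L _ L]) (use uv in \<open>auto simp: J_def L_def intro!: imageI\<close>)
    moreover have "ultra_map (h a) (ultra_cat u v) \<in> I" if "a < n" for a
      using uv I(1) that by (auto simp: J_def ultra_map_cat h_app intro!: I(4))
    ultimately show "ultra_cat u v \<in> J" by (auto simp: J_def)
  qed (auto simp: compact_imp_closed_fun ultra_cat_assoc continuous_on_ultra_cat)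
  define t where "t a = ultra_map (h a) r" for a
  have tI: "t a \<in> I" if "a < n" for a using r that by (auto simp: J_def t_def)
  then have tX: "t a \<in> ultra_on X" if "a < n" for a using I(1) that by auto
  have tt: "ultra_cat (t a) (t b) = t a" if "a < n" "b < n" for a b
  proof -
    have "ultra_cat (t b) (t b) = t b"
      unfolding t_def by (simp add: ultra_map_cat[symmetric] h_app r)
    then show ?thesis using I(5) tI that by auto
  qed
  have ut: "ultra (t a)" "t a X" if "a < n" for a using tX[OF that] by (auto simp: ultra_on_def)
  \<comment> \<open>Any letter could replace 0 here: \<open>t 0\<close> times \<open>t a\<close>
    equals \<open>t 0\<close>, so a set that is large for \<open>t 0\<close> is still reached after
    appending an instance for any letter \<open>a\<close>.\<close>
  obtain c where c: "t 0 {w. \<kappa> w = c}" using ultra_colour[OF ut(1)[OF n] fin] .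
  define C where "C = X \<inter> {w. \<kappa> w = c}"
  have C0: "t 0 C" using c ut[OF n] by (simp add: C_def ultra_Int)
  define D where "D = C \<inter> (\<Inter>a<n. {w. t a {v. w @ v \<in> C}})"
  have "t 0 (\<Inter>a\<in>{..<n}. {w. t a {v. w @ v \<in> C}})"
  proof (rule ultra_INT[OF ut(1)[OF n]])
    fix a assume "a \<in> {..<n}"
    then have "ultra_cat (t 0) (t a) C" using tt[of 0 a] n C0 by simp
    then show "t 0 {w. t a {v. w @ v \<in> C}}" by (simp add: ultra_cat_def)
  qed simp
  then have "t 0 D" using C0 ut(1)[OF n] by (simp add: D_def ultra_Int)
  then have "D \<noteq> {}" using ultra_empty[OF ut(1)[OF n]] by auto
  moreover have "D \<subseteq> lists {..<n}" by (auto simp: D_def C_def X_def)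
  moreover have "\<kappa> w = c" if "w \<in> D" for w using that by (auto simp: D_def C_def)
  moreover have "\<exists>z\<in>lists {..n}. \<forall>w\<in>F. \<forall>a<n. w @ a # map (\<lambda>i. if i = n then a else i) z \<in> D"
    if F: "finite F" "F \<subseteq> D" for F
  proof -
    \<comment> \<open>Membership in \<open>D\<close> asks for all letters \<open>b\<close> at once.
      As \<open>t a\<close> times \<open>t b\<close> equals \<open>t a\<close>, each of these
      finitely many conditions holds for \<open>t a\<close>-most \<open>v\<close>.\<close>
    have step: "t a {v. w @ v \<in> D}" if "w \<in> D" "a < n" for w a
    proof -
      have "t a {v. t b {v'. (w @ v) @ v' \<in> C}}" if "b < n" for b
      proof -
        have "ultra_cat (t a) (t b) {v. w @ v \<in> C}"
          using tt[OF \<open>a < n\<close> that] \<open>w \<in> D\<close> \<open>a < n\<close> by (auto simp: D_def)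
        then show ?thesis by (simp add: ultra_cat_def)
      qed
      then have "t a (\<Inter>b\<in>{..<n}. {v. t b {v'. (w @ v) @ v' \<in> C}})"
        by (intro ultra_INT[OF ut(1)[OF \<open>a < n\<close>]]) auto
      moreover have "t a {v. w @ v \<in> C}" using that by (auto simp: D_def)
      ultimately have "t a ({v. w @ v \<in> C} \<inter> (\<Inter>b\<in>{..<n}. {v. t b {v'. (w @ v) @ v' \<in> C}}))"
        using ut(1)[OF \<open>a < n\<close>] by (simp add: ultra_Int)
      then show ?thesis
        by (rule ultra_mono[OF ut(1)[OF \<open>a < n\<close>]]) (auto simp: D_def)
    qed
    have ur: "ultra r" "r L" using r by (auto simp: J_def ultra_on_def)
    have "r (\<Inter>(w, a)\<in>F \<times> {..<n}. {z. w @ h a z \<in> D})"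
      by (rule ultra_INT[OF ur(1)]) (use F step in \<open>auto simp: t_def ultra_map_def vimage_def\<close>)
    then have "r (L \<inter> (\<Inter>(w, a)\<in>F \<times> {..<n}. {z. w @ h a z \<in> D}))"
      using ur by (simp add: ultra_Int)
    then have "L \<inter> (\<Inter>(w, a)\<in>F \<times> {..<n}. {z. w @ h a z \<in> D}) \<noteq> {}"
      using ultra_empty ur(1) by metis
    then obtain z where z: "n # z \<in> L" "z \<in> lists {..n}"
      "\<And>w a. w \<in> F \<Longrightarrow> a < n \<Longrightarrow> w @ h a (n # z) \<in> D"
      by (auto simp: L_def)
    then show ?thesis by (intro bexI[of _ z]) (auto simp: h_def)
  qed
  ultimately show ?thesis by (rule that)
qed

section \<open>Rigid maps\<close>

text \<open>A rigid map encodes a word with infinitely many parameters over the alphabet \<open>{..<r}\<close>, for any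
  \<open>r\<close> such that it fixes \<open>{..<r}\<close>: letters below \<open>r\<close> are constants, and \<open>r + i\<close> stands for the parameter
  with index \<open>i\<close>. Reparametrizing a word substitutes its letters for the parameters and stops before the
  first parameter that receives none.\<close>

definition rigid :: "(nat \<Rightarrow> nat) \<Rightarrow> bool" where
  "rigid W \<longleftrightarrow> (\<forall>i. \<forall>j<W i. \<exists>i'<i. W i' = j) \<and> (\<forall>j. \<exists>i. W i = j)"

definition first_occ :: "(nat \<Rightarrow> nat) \<Rightarrow> nat \<Rightarrow> nat" where
  "first_occ W l = (LEAST i. W i = l)"

definition reparam :: "(nat \<Rightarrow> nat) \<Rightarrow> 'a list \<Rightarrow> 'a list" where
  "reparam W a = map (\<lambda>i. a ! W i) [0..<first_occ W (length a)]"

lemma rigid_below: "rigid W \<Longrightarrow> j < W i \<Longrightarrow> \<exists>i'<i. W i' = j"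
  by (simp add: rigid_def)

lemma rigid_le: "rigid W \<Longrightarrow> W i \<le> i"
proof (induction i rule: less_induct)
  case (less i)
  show ?case
  proof (rule ccontr)
    assume "\<not> W i \<le> i"
    then obtain i' where "i' < i" "W i' = i" using rigid_below[OF less.prems, of i i] by auto
    then show False using less.IH[of i'] less.prems by simp
  qed
qed

lemma rigid_id: "rigid (\<lambda>i. i)"
  by (auto simp: rigid_def)

lemma nth_first_occ: "rigid W \<Longrightarrow> W (first_occ W l) = l"
  unfolding first_occ_def by (rule LeastI_ex) (simp add: rigid_def)

lemma first_occ_le: "W i = l \<Longrightarrow> first_occ W l \<le> i"
  unfolding first_occ_def by (rule Least_le)

lemma first_occ_eqI: "W p = l \<Longrightarrow> (\<And>i. i < p \<Longrightarrow> W i \<noteq> l) \<Longrightarrow> first_occ W l = p"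
  unfolding first_occ_def by (rule Least_equality) (auto simp: not_less[symmetric])

text \<open>A letter above \<open>l\<close> before that position would force a still earlier
  occurrence of \<open>l\<close>.\<close>

lemma less_first_occ: "rigid W \<Longrightarrow> i < first_occ W l \<Longrightarrow> W i < l"
  using first_occ_le[of W i l] rigid_below[of W l i] first_occ_le[of W _ l]
  by (cases "W i" l rule: linorder_cases) force+

lemma first_occ_strict_mono: "rigid W \<Longrightarrow> l < l' \<Longrightarrow> first_occ W l < first_occ W l'"
  by (metis le_less_trans nth_first_occ first_occ_le rigid_below)

lemma rigid_comp:
  assumes "rigid V" "rigid W"
  shows "rigid (W \<circ> V)"
  unfolding rigid_def o_def
proof (intro conjI allI impI)
  fix i j assume "j < W (V i)"
  then obtain i1 where "i1 < V i" "W i1 = j" using assms rigid_below by blast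
  moreover from this obtain i2 where "i2 < i" "V i2 = i1" using assms rigid_below by blast
  ultimately show "\<exists>i'<i. W (V i') = j" by blast
next
  fix j show "\<exists>i. W (V i) = j" using nth_first_occ assms by metis
qed

lemma first_occ_comp:
  assumes "rigid V" "rigid W"
  shows "first_occ (W \<circ> V) l = first_occ V (first_occ W l)"
proof (rule first_occ_eqI)
  show "(W \<circ> V) (first_occ V (first_occ W l)) = l" by (simp add: nth_first_occ assms)
  fix i assume "i < first_occ V (first_occ W l)"
  then have "V i < first_occ W l" by (rule less_first_occ[OF assms(1)])
  then have "W (V i) < l" by (rule less_first_occ[OF assms(2)])
  then show "(W \<circ> V) i \<noteq> l" by simp
qed

lemma length_reparam [simp]: "length (reparam W a) = first_occ W (length a)"
  by (simp add: reparam_def)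

lemma nth_reparam: "i < first_occ W (length a) \<Longrightarrow> reparam W a ! i = a ! W i"
  by (simp add: reparam_def)

text \<open>Contravariance: the map composed on the left acts on the word first. Refinements are
  therefore composed to the left of the maps built so far.\<close>

lemma reparam_comp:
  assumes "rigid V" "rigid W"
  shows "reparam (W \<circ> V) a = reparam V (reparam W a)"
  by (rule nth_equalityI) (auto simp: first_occ_comp assms nth_reparam less_first_occ)

lemma reparam_map: "rigid W \<Longrightarrow> reparam W (map f a) = map f (reparam W a)"
  by (auto simp: reparam_def less_first_occ)

lemma set_reparam:
  assumes "rigid W" shows "set (reparam W a) = set a"
proof
  show "set (reparam W a) \<subseteq> set a" by (auto simp: reparam_def less_first_occ assms)
  show "set a \<subseteq> set (reparam W a)"
  proof
    fix x assume "x \<in> set a"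
    then obtain i where i: "i < length a" "x = a ! i" by (metis in_set_conv_nth)
    then have "first_occ W i < first_occ W (length a)" by (intro first_occ_strict_mono assms)
    then show "x \<in> set (reparam W a)"
      using i nth_reparam[of "first_occ W i" W a] by (metis assms length_reparam nth_mem nth_first_occ)
  qed
qed

text \<open>Position \<open>first_occ W (length a)\<close> is both where \<open>a\<close> alone
  would be cut and where the letter \<open>x\<close> is first read.\<close>

lemma reparam_append_Cons:
  assumes W: "rigid W"
  obtains v' where "reparam W (a @ x # v) = reparam W a @ x # v'" "set v' \<subseteq> set (a @ x # v)"
proof -
  let ?c = "reparam W (a @ x # v)" and ?p = "first_occ W (length a)"
  have p: "?p < length ?c" by (auto intro!: first_occ_strict_mono W)
  have "take ?p ?c = reparam W a"
    by (rule nth_equalityI) (use p less_first_occ[OF W, of _ "length a"] in \<open>auto simp: nth_reparam nth_append\<close>)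
  moreover have "?c ! ?p = x" using p by (simp add: nth_reparam nth_first_occ W)
  ultimately have eq: "?c = reparam W a @ x # drop (Suc ?p) ?c" using id_take_nth_drop[OF p] by simp
  have "set (drop (Suc ?p) ?c) \<subseteq> set ?c" by (rule set_drop_subset)
  then show ?thesis using that[OF eq] set_reparam[OF W] by metis
qed

lemma reparam_fixed_prefix:
  assumes W: "rigid W" and fixed: "\<And>i. i < length a \<Longrightarrow> W i = i"
  obtains v' where "reparam W (a @ v) = a @ v'" "set v' \<subseteq> set (a @ v)"
proof -
  let ?c = "reparam W (a @ v)"
  have len: "length a \<le> length ?c"
  proof (rule ccontr)
    assume "\<not> length a \<le> length ?c"
    then have "first_occ W (length (a @ v)) < length a" by simp
    moreover from fixed[OF this] nth_first_occ[OF W] have "first_occ W (length (a @ v)) = length (a @ v)" by metis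
    ultimately show False by simp
  qed
  have "take (length a) ?c = a"
    by (rule nth_equalityI) (use len fixed in \<open>auto simp: nth_reparam nth_append\<close>)
  then have eq: "?c = a @ drop (length a) ?c" by (metis append_take_drop_id)
  have "set (drop (length a) ?c) \<subseteq> set ?c" by (rule set_drop_subset)
  then show ?thesis using that[OF eq] set_reparam[OF W] by metis
qed

text \<open>The range includes \<open>first_occ W (length a)\<close> itself, because the value there
  is what places the cut.\<close>

lemma reparam_cong:
  assumes "rigid W" "\<And>i. i \<le> first_occ W (length a) \<Longrightarrow> W' i = W i"
  shows "reparam W' a = reparam W a"
proof -
  have "first_occ W' (length a) = first_occ W (length a)"
  proof (rule first_occ_eqI)
    show "W' (first_occ W (length a)) = length a" using assms nth_first_occ by simp
    show "W' i \<noteq> length a" if "i < first_occ W (length a)" for i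
      using assms(2)[of i] less_first_occ[OF assms(1) that] that by simp
  qed
  then show ?thesis using assms by (simp add: reparam_def)
qed

text \<open>The finite counterpart of \<^const>\<open>reparam\<close>; if \<open>y\<close> supplies all letters, there is no truncation.\<close>

definition inst_word :: "nat list \<Rightarrow> 'a list \<Rightarrow> 'a list" where
  "inst_word a y = map ((!) y) (takeWhile (\<lambda>i. i < length y) a)"

text \<open>The first letter of \<open>a\<close> that \<open>y\<close> does not supply is still the
  first such letter after reparametrization, so the two truncations commute.\<close>

lemma reparam_inst_word:
  assumes W: "rigid W"
  shows "reparam W (inst_word a y) = inst_word (reparam W a) y"
proof -
  let ?Q = "\<lambda>i. i < length y" and ?p = "takeWhile (\<lambda>i. i < length y) a"
  have "takeWhile ?Q (reparam W a) = reparam W ?p"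
  proof (cases "dropWhile ?Q a")
    case Nil
    then have "\<forall>i\<in>set a. ?Q i" by (simp add: dropWhile_eq_Nil_conv)
    then show ?thesis using set_reparam[OF W, of a] by (simp add: takeWhile_eq_all_conv[THEN iffD2])
  next
    case (Cons x q)
    then have "a = ?p @ x # q" using takeWhile_dropWhile_id[of ?Q a] by simp
    moreover obtain v' where "reparam W (?p @ x # q) = reparam W ?p @ x # v'"
      using reparam_append_Cons[OF W] by metis
    ultimately have "reparam W a = reparam W ?p @ x # v'" by simp
    moreover have "\<not> ?Q x" using Cons hd_dropWhile[of ?Q a] by simp
    moreover have "\<forall>i\<in>set (reparam W ?p). ?Q i" using set_reparam[OF W, of ?p] by (auto dest: set_takeWhileD)
    ultimately show ?thesis by (simp add: takeWhile_append2)
  qed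
  then show ?thesis by (simp add: inst_word_def reparam_map W)
qed

text \<open>The finite initial segments of rigid maps, known as restricted growth strings.\<close>

definition restricted_growth :: "nat list \<Rightarrow> bool" where
  "restricted_growth a \<longleftrightarrow> (\<forall>i<length a. \<forall>j<a ! i. \<exists>i'<i. a ! i' = j)"

lemma restricted_growth_reparam:
  assumes "rigid W" "restricted_growth a" shows "restricted_growth (reparam W a)"
  unfolding restricted_growth_def
proof (intro allI impI)
  fix i j assume i: "i < length (reparam W a)" and j: "j < reparam W a ! i"
  then have "W i < length a" "j < a ! W i" by (auto simp: nth_reparam less_first_occ assms)
  then obtain i1 where i1: "i1 < W i" "a ! i1 = j" using assms(2) by (auto simp: restricted_growth_def)
  then obtain i2 where "i2 < i" "W i2 = i1" using rigid_below[OF assms(1)] by blast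
  then show "\<exists>i'<i. reparam W a ! i' = j" using i i1 by (auto simp: nth_reparam intro!: exI[of _ i2])
qed

lemma map_nth_prefix: "set q \<subseteq> {..<length a} \<Longrightarrow> map ((!) (a @ b)) q = map ((!) a) q"
  by (auto simp: nth_append)

text \<open>The extension property of \<open>D\<close> from \<open>left_variable_words\<close> is
  iterated: each round appends one new parameter and a tail while all instances stay in the
  monochromatic set \<open>D\<close>. At every stage these instances form a finite set, as the
  property requires.\<close>

lemma rigid_pigeonhole:
  fixes \<kappa> :: "nat list \<Rightarrow> 'x"
  assumes fin: "finite (range \<kappa>)" and n: "n > 0"
  shows "\<exists>W c. rigid W \<and> (\<forall>i<n. W i = i) \<and>
    (\<forall>u. set u \<subseteq> {..<n} \<longrightarrow> \<kappa> (reparam W ([0..<n] @ u)) = c)"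
proof -
  have fin': "finite (range (\<lambda>w. \<kappa> ([0..<n] @ w)))" by (rule finite_subset[OF _ fin]) auto
  obtain D c where D: "D \<noteq> {}" "D \<subseteq> lists {..<n}" and c: "\<And>w. w \<in> D \<Longrightarrow> \<kappa> ([0..<n] @ w) = c"
    and ext: "\<And>F. finite F \<Longrightarrow> F \<subseteq> D \<Longrightarrow>
      \<exists>z\<in>lists {..n}. \<forall>w\<in>F. \<forall>a<n. w @ a # map (\<lambda>i. if i = n then a else i) z \<in> D"
    by (rule left_variable_words[OF fin' n]) blast
  define \<sigma> where "\<sigma> u = (!) ([0..<n] @ u)" for u
  \<comment> \<open>At stage \<open>l\<close> the parameters are \<open>n\<close> to
    \<open>n + l - 1\<close>, and the letters of \<open>u\<close> are their values.\<close>
  define inv where "inv l q \<longleftrightarrow> restricted_growth ([0..<n] @ q) \<and> set ([0..<n] @ q) = {..<n + l} \<and>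
    (\<forall>u. set u \<subseteq> {..<n} \<longrightarrow> length u = l \<longrightarrow> map (\<sigma> u) q \<in> D)" for l q
  have "\<exists>f. \<forall>l. inv l (f l) \<and> (\<exists>z. f (Suc l) = f l @ (n + l) # z)"
  proof (rule dependent_nat_choice)
    obtain w where w: "w \<in> D" using D by auto
    then have wn: "set w \<subseteq> {..<n}" using D by auto
    have "restricted_growth ([0..<n] @ w)"
      unfolding restricted_growth_def
    proof (intro allI impI)
      fix i j assume i: "i < length ([0..<n] @ w)" and j: "j < ([0..<n] @ w) ! i"
      have "j < i \<and> j < n"
      proof (cases "i < n")
        case True then show ?thesis using j by (simp add: nth_append)
      next
        case False
        then have "i - n < length w" using i by simp
        then have "w ! (i - n) < n" using wn nth_mem by blast
        then show ?thesis using False j by (simp add: nth_append)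
      qed
      then show "\<exists>i'<i. ([0..<n] @ w) ! i' = j" by (intro exI[of _ j]) (simp add: nth_append)
    qed
    moreover have "map ((!) [0..<n]) w = w" using wn by (auto intro!: map_idI)
    moreover have "set ([0..<n] @ w) = {..<n}" using wn by auto
    ultimately have "inv 0 w" using w by (simp add: inv_def \<sigma>_def)
    then show "\<exists>q. inv 0 q" ..
  next
    fix q l assume q: "inv l q"
    define F where "F = (\<lambda>u. map (\<sigma> u) q) ` {u. set u \<subseteq> {..<n} \<and> length u = l}"
    have "finite F" unfolding F_def by (intro finite_imageI finite_lists_length_eq) simp
    moreover have "F \<subseteq> D" using q by (auto simp: F_def inv_def)
    ultimately have "\<exists>z\<in>lists {..n}. \<forall>w\<in>F. \<forall>a<n. w @ a # map (\<lambda>i. if i = n then a else i) z \<in> D"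
      by (rule ext)
    then obtain z where z: "z \<in> lists {..n}"
      and zD: "\<forall>w\<in>F. \<forall>a<n. w @ a # map (\<lambda>i. if i = n then a else i) z \<in> D" ..
    \<comment> \<open>The variable \<open>n\<close> of the tail is renamed to the new parameter
      \<open>n + l\<close>, since \<open>n\<close> itself may already name the first
      parameter.\<close>
    define z' where "z' = map (\<lambda>i. if i = n then n + l else i) z"
    define p where "p = [0..<n] @ q"
    have p: "restricted_growth p" "set p = {..<n + l}" using q by (auto simp: inv_def p_def)
    have z': "set z' \<subseteq> {..n + l}" using z by (auto simp: z'_def)
    have ran: "\<exists>i'<length p. p ! i' = j" if "j < n + l" for j
      using p(2) that by (metis in_set_conv_nth lessThan_iff)
    have "restricted_growth (p @ (n + l) # z')"
      unfolding restricted_growth_def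
    proof (intro allI impI)
      fix i j assume i: "i < length (p @ (n + l) # z')" and j: "j < (p @ (n + l) # z') ! i"
      show "\<exists>i'<i. (p @ (n + l) # z') ! i' = j"
      proof (cases "i < length p")
        case True
        then obtain i' where "i' < i" "p ! i' = j" using p(1) j by (auto simp: restricted_growth_def nth_append)
        then show ?thesis using True by (auto simp: nth_append intro!: exI[of _ i'])
      next
        case False
        have "(p @ (n + l) # z') ! i \<in> set ((n + l) # z')"
          using False i by (metis in_set_conv_nth length_append nat_add_left_cancel_less
              not_less nth_append_right le_add_diff_inverse)
        then have "(p @ (n + l) # z') ! i \<le> n + l" using z' by auto
        then obtain i' where "i' < length p" "p ! i' = j" using ran[of j] j by auto
        then show ?thesis using False by (auto simp: nth_append intro!: exI[of _ i'])
      qed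
    qed
    moreover have "set (p @ (n + l) # z') = {..<n + Suc l}" using p z' by auto
    moreover have "map (\<sigma> u) (q @ (n + l) # z') \<in> D" if u: "set u \<subseteq> {..<n}" "length u = Suc l" for u
    proof -
      obtain v a where va: "u = v @ [a]" using u(2) by (metis length_Suc_conv_rev)
      have "map (\<sigma> u) q = map (\<sigma> v) q"
        unfolding \<sigma>_def va append_assoc[symmetric]
        by (rule map_nth_prefix) (use q u va in \<open>auto simp: inv_def\<close>)
      moreover have "\<sigma> u (n + l) = a" using u va by (auto simp: \<sigma>_def nth_append)
      moreover have "map (\<sigma> u) z' = map (\<lambda>i. if i = n then a else i) z"
        using u va z by (auto simp: \<sigma>_def z'_def nth_append)
      moreover have "map (\<sigma> v) q \<in> F" "a < n" using u va by (auto simp: F_def)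
      ultimately show ?thesis using zD by (simp del: map_eq_conv)
    qed
    ultimately show "\<exists>q'. inv (Suc l) q' \<and> (\<exists>z. q' = q @ (n + l) # z)"
      by (intro exI[of _ "q @ (n + l) # z'"]) (simp add: inv_def p_def)
  qed
  then obtain f where f: "\<And>l. inv l (f l)" "\<And>l. \<exists>z. f (Suc l) = f l @ (n + l) # z" by blast
  define P where "P l = [0..<n] @ f l" for l
  have PS: "\<exists>z. P (Suc l) = P l @ (n + l) # z" for l using f(2)[of l] by (auto simp: P_def)
  have P: "restricted_growth (P l)" "set (P l) = {..<n + l}" for l using f(1)[of l] by (auto simp: inv_def P_def)
  have pre: "\<exists>z. P l' = P l @ z" if "l \<le> l'" for l l'
    using that
  proof (induction l' rule: dec_induct)
    case (step m) then show ?case using PS[of m] by auto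
  qed simp
  have len: "n + l \<le> length (P l)" for l
    using card_length[of "P l"] P(2)[of l] by simp
  define W where "W i = P (Suc i) ! i" for i
  have W: "W i = P l ! i" if "i < length (P l)" for i l
  proof -
    have "i < length (P (Suc i))" using len[of "Suc i"] n by linarith
    then show ?thesis
      using pre[of l "Suc i"] pre[of "Suc i" l] that
      by (cases "l \<le> Suc i") (auto simp: W_def nth_append)
  qed
  have "rigid W"
    unfolding rigid_def
  proof (intro conjI allI impI)
    fix i j assume j: "j < W i"
    have i: "i < length (P (Suc i))" using len[of "Suc i"] n by linarith
    then obtain i' where "i' < i" "P (Suc i) ! i' = j"
      using P(1)[of "Suc i"] j by (auto simp: restricted_growth_def W_def)
    then show "\<exists>i'<i. W i' = j" using W[of i' "Suc i"] i by (auto intro!: exI[of _ i'])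
  next
    fix j
    have "j \<in> set (P (Suc j))" using P(2)[of "Suc j"] by simp
    then show "\<exists>i. W i = j" using W by (metis in_set_conv_nth)
  qed
  moreover have "W i = i" if "i < n" for i
    using W[of i 0] that len[of 0] by (simp add: P_def nth_append)
  moreover have "\<kappa> (reparam W ([0..<n] @ u)) = c" if u: "set u \<subseteq> {..<n}" for u
  proof -
    define l where "l = length u"
    obtain z where z: "P (Suc l) = P l @ (n + l) # z" using PS by blast
    have "W (length (P l)) = n + l" using W[of "length (P l)" "Suc l"] z by simp
    moreover have "W i \<noteq> n + l" if "i < length (P l)" for i
      using W[OF that] nth_mem[OF that] P(2)[of l] by auto
    \<comment> \<open>The parameter \<open>n + l\<close> enters right after stage \<open>l\<close>,
      so \<open>[0..<n] @ u\<close> with \<open>u\<close> of length \<open>l\<close> is cut exactly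
      where \<open>f l\<close> ends.\<close>
    ultimately have "first_occ W (n + l) = length (P l)" by (rule first_occ_eqI)
    then have "reparam W ([0..<n] @ u) = map (\<lambda>i. ([0..<n] @ u) ! (P l ! i)) [0..<length (P l)]"
      by (simp add: reparam_def l_def W)
    also have "\<dots> = map (\<sigma> u) (P l)"
      by (rule nth_equalityI) (auto simp: \<sigma>_def)
    also have "\<dots> = [0..<n] @ map (\<sigma> u) (f l)"
      by (auto simp: P_def \<sigma>_def nth_append intro!: map_idI)
    finally show ?thesis using c[of "map (\<sigma> u) (f l)"] f(1)[of l] u by (auto simp: inv_def l_def)
  qed
  ultimately show ?thesis by blast
qed

section \<open>The Carlson--Simpson theorem\<close>

text \<open>The pigeonhole is applied with \<open>n + 1\<close> constants that stand for the
  positions of \<open>b @ [j]\<close>. All letters up to \<open>j\<close> occur there, so every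
  admissible \<open>v\<close> is the image of a word over these positions and cannot influence the
  colour.\<close>

lemma rigid_fusion_step:
  fixes \<kappa> :: "nat list \<Rightarrow> 'x"
  assumes fin: "finite (range \<kappa>)"
  shows "\<exists>V. rigid V \<and> (\<forall>i<Suc n. V i = i) \<and>
    (\<forall>b v. length b = n \<longrightarrow> set b = {..<j} \<longrightarrow> set v \<subseteq> {..j} \<longrightarrow>
      \<kappa> (reparam W (reparam V (b @ j # v))) = \<kappa> (reparam W (reparam V (b @ [j]))))"
proof -
  define B where "B = {b. set b \<subseteq> {..<j} \<and> length b = n}"
  have finB: "finite B" unfolding B_def by (rule finite_lists_length_eq) simp
  \<comment> \<open>One colouring records the colours for all of the finitely many \<open>b\<close>
    simultaneously.\<close>
  define \<kappa>' where "\<kappa>' x = (\<lambda>b\<in>B. \<kappa> (reparam W (map ((!) (b @ [j])) x)))" for x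
  have "range \<kappa>' \<subseteq> B \<rightarrow>\<^sub>E range \<kappa>" by (auto simp: \<kappa>'_def)
  then have fin': "finite (range \<kappa>')" by (rule finite_subset) (intro finite_PiE finB fin)
  obtain V c where V: "rigid V" "\<forall>i<Suc n. V i = i"
    and c: "\<forall>u. set u \<subseteq> {..<Suc n} \<longrightarrow> \<kappa>' (reparam V ([0..<Suc n] @ u)) = c"
    using rigid_pigeonhole[OF fin' zero_less_Suc[of n]] by blast
  have "\<kappa> (reparam W (reparam V (b @ j # v))) = c b"
    if b: "length b = n" "set b = {..<j}" and v: "set v \<subseteq> {..j}" for b v
  proof -
    let ?s = "(!) (b @ [j])"
    have "\<exists>i<Suc n. ?s i = x" if "x \<in> set v" for x
    proof -
      have "x \<in> set (b @ [j])" using that v b by (auto simp: le_less)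
      then show ?thesis using b(1) by (metis in_set_conv_nth length_append_singleton)
    qed
    then obtain g where g: "\<And>x. x \<in> set v \<Longrightarrow> g x < Suc n \<and> ?s (g x) = x" by metis
    have "map ?s (map g v) = v" using g by (auto intro!: map_idI)
    moreover have "map ?s [0..<Suc n] = b @ [j]"
      using map_nth[of "b @ [j]"] b by simp
    ultimately have "map ?s ([0..<Suc n] @ map g v) = b @ j # v" by (simp del: map_map upt_Suc)
    then have "reparam V (b @ j # v) = map ?s (reparam V ([0..<Suc n] @ map g v))"
      using reparam_map[OF V(1)] by metis
    moreover have "set (map g v) \<subseteq> {..<Suc n}" using g by auto
    moreover have "b \<in> B" using b by (simp add: B_def)
    ultimately show ?thesis using fun_cong[OF c[rule_format, of "map g v"], of b] by (simp add: \<kappa>'_def)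
  qed
  then have "\<kappa> (reparam W (reparam V (b @ j # v))) = \<kappa> (reparam W (reparam V (b @ [j])))"
    if "length b = n" "set b = {..<j}" "set v \<subseteq> {..j}" for b v using that by simp
  then show ?thesis using V by blast
qed

text \<open>Diagonalization of a sequence of rigid maps, the \<open>n\<close>-th of which fixes the letters up to \<open>n\<close> and
  makes the colour of \<open>b @ j # v\<close> independent of \<open>v\<close> for all \<open>b\<close> of length \<open>n\<close>.\<close>

lemma rigid_fusion:
  fixes \<kappa> :: "nat list \<Rightarrow> 'x"
  assumes fin: "finite (range \<kappa>)"
  shows "\<exists>W. rigid W \<and> (\<forall>i<r. W i = i) \<and>
    (\<forall>b v. r \<le> length b \<longrightarrow> set b = {..<j} \<longrightarrow> set v \<subseteq> {..j} \<longrightarrow>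
      \<kappa> (reparam W (b @ j # v)) = \<kappa> (reparam W (b @ [j])))"
proof -
  define step where "step n W V \<longleftrightarrow> rigid V \<and> (\<forall>i<Suc n. V i = i) \<and> (\<forall>i<r. V i = i) \<and>
    (r \<le> n \<longrightarrow> (\<forall>b v. length b = n \<longrightarrow> set b = {..<j} \<longrightarrow> set v \<subseteq> {..j} \<longrightarrow>
      \<kappa> (reparam W (reparam V (b @ j # v))) = \<kappa> (reparam W (reparam V (b @ [j])))))" for n W V
  have ex: "\<exists>V. step n W V" for n W
  proof (cases "r \<le> n")
    case True
    then have *: "\<forall>i<r. V i = i" if "\<forall>i<Suc n. V i = i" for V :: "nat \<Rightarrow> nat"
      using that by simp
    show ?thesis unfolding step_def using rigid_fusion_step[OF fin, of n j W] * by blast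
  next
    case False
    then show ?thesis by (intro exI[of _ "\<lambda>i. i"]) (simp add: step_def rigid_id)
  qed
  have "\<exists>W. \<forall>n. (rigid (W n) \<and> (\<forall>i<r. W n i = i)) \<and> (\<exists>V. step n (W n) V \<and> W (Suc n) = V \<circ> W n)"
  proof (rule dependent_nat_choice)
    show "\<exists>W. rigid W \<and> (\<forall>i<r. W i = i)" by (intro exI[of _ "\<lambda>i. i"]) (simp add: rigid_id)
  next
    fix W :: "nat \<Rightarrow> nat" and n assume W: "rigid W \<and> (\<forall>i<r. W i = i)"
    obtain V where V: "step n W V" using ex by blast
    then have "rigid V" "\<forall>i<r. V i = i" unfolding step_def by blast+
    then have "rigid (V \<circ> W) \<and> (\<forall>i<r. (V \<circ> W) i = i)" using W by (simp add: rigid_comp)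
    then show "\<exists>W'. (rigid W' \<and> (\<forall>i<r. W' i = i)) \<and> (\<exists>V. step n W V \<and> W' = V \<circ> W)"
      using V by blast
  qed
  then obtain W where W: "\<forall>n. (rigid (W n) \<and> (\<forall>i<r. W n i = i)) \<and>
    (\<exists>V. step n (W n) V \<and> W (Suc n) = V \<circ> W n)" ..
  have Wn: "rigid (W n)" "\<And>i. i < r \<Longrightarrow> W n i = i" for n using W by simp_all
  have "\<forall>n. \<exists>V. step n (W n) V \<and> W (Suc n) = V \<circ> W n" using W by simp
  then obtain V where VW: "\<forall>n. step n (W n) (V n) \<and> W (Suc n) = V n \<circ> W n"
    using choice[of "\<lambda>n V. step n (W n) V \<and> W (Suc n) = V \<circ> W n"] by auto
  have V: "step n (W n) (V n)" and WS: "W (Suc n) = V n \<circ> W n" for n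
    using VW by simp_all
  have rV: "rigid (V n)" and fV: "\<And>i. i < Suc n \<Longrightarrow> V n i = i" for n
    using V[of n] unfolding step_def by blast+
  have hV: "\<kappa> (reparam (W n) (reparam (V n) (b @ j # v))) = \<kappa> (reparam (W n) (reparam (V n) (b @ [j])))"
    if "r \<le> n" "length b = n" "set b = {..<j}" "set v \<subseteq> {..j}" for n b v
    using V[of n] that unfolding step_def by blast
  have reparam_Suc: "reparam (W (Suc n)) a = reparam (W n) (reparam (V n) a)" for n and a :: "nat list"
    unfolding WS by (rule reparam_comp[OF Wn(1) rV])
  have stab: "W m i = W n i" if "n \<le> m" "W n i \<le> n" for m n i
    using that(1)
  proof (induction m rule: dec_induct)
    case (step m) then show ?case using that fV[of "W n i" m] by (simp add: WS)
  qed simp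
  \<comment> \<open>By \<open>rigid_le\<close> the value \<open>W n i\<close> is at most
    \<open>i\<close>, and \<open>V m\<close> fixes letters up to \<open>m\<close>. So
    \<open>W n i\<close> no longer changes once \<open>n \<ge> i\<close>, and the diagonal is the
    pointwise limit.\<close>
  define D where "D i = W i i" for i
  have DW: "D i = W n i" if "i \<le> n" for i n
    using stab[OF that] rigid_le[OF Wn(1)] by (simp add: D_def)
  have rD: "rigid D"
    unfolding rigid_def
  proof (intro conjI allI impI)
    fix i j assume "j < D i"
    then obtain i' where "i' < i" "W i i' = j" using rigid_below[OF Wn(1)[of i]] by (auto simp: D_def)
    then show "\<exists>i'<i. D i' = j" using DW[of i' i] by (auto intro!: exI[of _ i'])
  next
    fix j
    let ?i = "first_occ (W j) j"
    have i: "W j ?i = j" by (rule nth_first_occ[OF Wn(1)])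
    then have "j \<le> ?i" using rigid_le[OF Wn(1)] by metis
    then have "D ?i = j" using stab[of j ?i ?i] i by (simp add: D_def)
    then show "\<exists>i. D i = j" ..
  qed
  \<comment> \<open>From stage \<open>length b + 1\<close> on, each further \<open>V m\<close> fixes
    all positions of \<open>b @ [j]\<close> and only replaces \<open>v\<close> by another admissible
    tail.\<close>
  have const: "\<kappa> (reparam (W m) (b @ j # v)) = \<kappa> (reparam (W (Suc (length b))) (b @ [j]))"
    if b: "r \<le> length b" "set b = {..<j}" and "set v \<subseteq> {..j}" and "Suc (length b) \<le> m" for b v m
    using that(4,3)
  proof (induction m arbitrary: v rule: dec_induct)
    case base
    then show ?case using hV[of "length b" b v] b by (simp add: reparam_Suc)
  next
    case (step m)
    have "V m i = i" if "i < length (b @ [j])" for i using fV[of i m] that step.hyps by simp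
    then obtain v' where v': "reparam (V m) ((b @ [j]) @ v) = (b @ [j]) @ v'"
      "set v' \<subseteq> set ((b @ [j]) @ v)"
      by (rule reparam_fixed_prefix[OF rV])
    then have "set v' \<subseteq> {..j}" using b step.prems by force
    then show ?case using step.IH[of v'] v' by (simp add: reparam_Suc)
  qed
  have "\<kappa> (reparam D (b @ j # v)) = \<kappa> (reparam (W (Suc (length b))) (b @ [j]))"
    if b: "r \<le> length b" "set b = {..<j}" and v: "set v \<subseteq> {..j}" for b v
  proof -
    \<comment> \<open>\<open>W m\<close> agrees with \<open>D\<close> up to index \<open>m\<close>,
      hence up to and including the cut of this word.\<close>
    define m where "m = max (Suc (length b)) (first_occ D (length (b @ j # v)))"
    have "reparam (W m) (b @ j # v) = reparam D (b @ j # v)"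
      by (rule reparam_cong[OF rD], rule DW[symmetric]) (simp add: m_def del: length_append list.size)
    then show ?thesis using const[OF b v, of m] by (simp add: m_def)
  qed
  from this[of _ "[]"] this have "\<kappa> (reparam D (b @ j # v)) = \<kappa> (reparam D (b @ [j]))"
    if "r \<le> length b" "set b = {..<j}" "set v \<subseteq> {..j}" for b v using that by simp
  moreover have "D i = i" if "i < r" for i using Wn(2)[OF that] by (simp add: D_def)
  ultimately show ?thesis using rD by blast
qed

text \<open>For \<open>r \<le> k\<close>, the words with \<open>r\<close> constants and
  \<open>k - r\<close> parameters, all occurring. With the constants listed first, restricted growth
  orders constants and parameters alike.\<close>

definition growth_words :: "nat \<Rightarrow> nat \<Rightarrow> nat list set" where
  "growth_words r k = {a. restricted_growth a \<and> take r a = [0..<r] \<and> set a = {..<k}}"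

lemma length_growth_words: "a \<in> growth_words r k \<Longrightarrow> r \<le> length a"
  unfolding growth_words_def by (metis (mono_tags, lifting) diff_zero length_take length_upt mem_Collect_eq min.cobounded1)

lemma reparam_growth_words:
  assumes W: "rigid W" "\<And>i. i < r \<Longrightarrow> W i = i" and a: "a \<in> growth_words r k"
  shows "reparam W a \<in> growth_words r k"
proof -
  have "a = [0..<r] @ drop r a" using a by (metis (mono_tags, lifting) growth_words_def append_take_drop_id mem_Collect_eq)
  moreover obtain v' where "reparam W ([0..<r] @ drop r a) = [0..<r] @ v'"
    by (rule reparam_fixed_prefix[OF W(1), of "[0..<r]" "drop r a"]) (use W(2) in auto)
  ultimately have "take r (reparam W a) = [0..<r]" by simp
  then show ?thesis using a by (simp add: growth_words_def restricted_growth_reparam set_reparam W(1))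
qed

text \<open>Induction on the number of letters. After \<open>rigid_fusion\<close> the colour depends
  only on the part \<open>b\<close> before the first \<open>k\<close>; this is a growth word over
  \<open>k\<close> letters, so the induction hypothesis applies to the induced colouring. Without
  parameters the claim is \<open>rigid_pigeonhole\<close>.\<close>

theorem carlson_simpson:
  fixes \<kappa> :: "nat list \<Rightarrow> 'x"
  assumes r: "0 < r" and "r \<le> k" and "finite (range \<kappa>)"
  shows "\<exists>W c. rigid W \<and> (\<forall>i<r. W i = i) \<and> (\<forall>a\<in>growth_words r k. \<kappa> (reparam W a) = c)"
  using assms(2,3)
proof (induction k arbitrary: \<kappa> rule: dec_induct)
  case base
  obtain W c where W: "rigid W" "\<forall>i<r. W i = i"
    and c: "\<forall>u. set u \<subseteq> {..<r} \<longrightarrow> \<kappa> (reparam W ([0..<r] @ u)) = c"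
    using rigid_pigeonhole[OF base r] by blast
  have "\<kappa> (reparam W a) = c" if "a \<in> growth_words r r" for a
  proof -
    have "a = [0..<r] @ drop r a" using that by (metis (mono_tags, lifting) growth_words_def append_take_drop_id mem_Collect_eq)
    moreover have "set (drop r a) \<subseteq> {..<r}" using that set_drop_subset[of r a] by (simp add: growth_words_def)
    ultimately show ?thesis using c by metis
  qed
  then show ?case using W by blast
next
  case (step k)
  obtain W where W: "rigid W" "\<forall>i<r. W i = i"
    and hom: "\<forall>b v. r \<le> length b \<longrightarrow> set b = {..<k} \<longrightarrow> set v \<subseteq> {..k} \<longrightarrow>
      \<kappa> (reparam W (b @ k # v)) = \<kappa> (reparam W (b @ [k]))"
    using rigid_fusion[OF step.prems, of r k] by blast
  have "finite (range (\<lambda>b. \<kappa> (reparam W (b @ [k]))))"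
    by (rule finite_subset[OF _ step.prems]) auto
  from step.IH[OF this] obtain V c where V: "rigid V" "\<forall>i<r. V i = i"
    and c: "\<And>b. b \<in> growth_words r k \<Longrightarrow> \<kappa> (reparam W (reparam V b @ [k])) = c" by blast
  have "\<kappa> (reparam (V \<circ> W) a) = c" if a: "a \<in> growth_words r (Suc k)" for a
  proof -
    have "k \<in> set a" using a by (simp add: growth_words_def)
    then obtain b v where bv: "a = b @ k # v" "k \<notin> set b" by (metis split_list_first)
    have ra: "restricted_growth a" "take r a = [0..<r]" "set a = {..<Suc k}" using a by (auto simp: growth_words_def)
    have "r \<le> length b"
    proof (rule ccontr)
      assume "\<not> r \<le> length b"
      then have "take r a ! length b = k" using bv by (simp add: nth_append take_Cons')
      then show False using ra(2) \<open>\<not> r \<le> length b\<close> step.hyps by simp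
    qed
    moreover have "restricted_growth b"
      unfolding restricted_growth_def
    proof (intro allI impI)
      fix i j assume i: "i < length b" "j < b ! i"
      then obtain i' where "i' < i" "a ! i' = j"
        using ra(1) bv unfolding restricted_growth_def
        by (metis length_append nth_append_left trans_less_add1)
      then show "\<exists>i'<i. b ! i' = j" using bv i by (auto simp: nth_append intro!: exI[of _ i'])
    qed
    moreover have sb: "set b = {..<k}"
    proof
      show "set b \<subseteq> {..<k}"
      proof
        fix x assume "x \<in> set b"
        then have "x < Suc k" "x \<noteq> k" using ra(3) bv by auto
        then show "x \<in> {..<k}" by simp
      qed
      show "{..<k} \<subseteq> set b"
      proof
        fix x assume "x \<in> {..<k}"
        then have "x < a ! length b" "length b < length a" using bv by auto
        then obtain i' where "i' < length b" "a ! i' = x" using ra(1) unfolding restricted_growth_def by blast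
        then show "x \<in> set b" using bv by (auto simp: nth_append)
      qed
    qed
    ultimately have b: "b \<in> growth_words r k" using ra(2) bv by (simp add: growth_words_def)
    have "\<And>i. i < r \<Longrightarrow> V i = i" using V by simp
    then have Vb: "reparam V b \<in> growth_words r k" by (rule reparam_growth_words[OF V(1) _ b])
    obtain v' where v': "reparam V a = reparam V b @ k # v'" "set v' \<subseteq> set a"
      using reparam_append_Cons[OF V(1), of b k v] bv by metis
    have "set v' \<subseteq> {..k}" using v'(2) ra(3) by (simp add: lessThan_Suc_atMost)
    then have "\<kappa> (reparam W (reparam V a)) = \<kappa> (reparam W (reparam V b @ [k]))"
      unfolding v' using length_growth_words[OF Vb] Vb by (intro hom[rule_format]) (simp_all add: growth_words_def)
    then show ?thesis using c[OF b] by (simp add: reparam_comp W V)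
  qed
  moreover have "rigid (V \<circ> W)" "\<forall>i<r. (V \<circ> W) i = i" using V W by (auto intro: rigid_comp)
  ultimately show ?case by blast
qed

text \<open>The values of \<open>k\<close> are treated in turn. Those already homogeneous stay so,
  because a reparametrization that fixes the constants maps \<open>growth_words r k\<close> into
  itself.\<close>

corollary carlson_simpson_upto:
  fixes \<kappa> :: "nat \<Rightarrow> nat list \<Rightarrow> 'x"
  assumes r: "0 < r" and fin: "\<And>k. finite (range (\<kappa> k))"
  shows "\<exists>W c. rigid W \<and> (\<forall>k\<le>K. r \<le> k \<longrightarrow> (\<forall>a\<in>growth_words r k. \<kappa> k (reparam W a) = c k))"
proof -
  have "\<exists>W. rigid W \<and> (\<forall>i<r. W i = i) \<and> (\<forall>k<n. r \<le> k \<longrightarrow> (\<exists>c. \<forall>a\<in>growth_words r k. \<kappa> k (reparam W a) = c))" for n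
  proof (induction n)
    case 0 show ?case by (intro exI[of _ "\<lambda>i. i"]) (simp add: rigid_id)
  next
    case (Suc n)
    then obtain W where W: "rigid W" "\<And>i. i < r \<Longrightarrow> W i = i"
      "\<And>k. k < n \<Longrightarrow> r \<le> k \<Longrightarrow> \<exists>c. \<forall>a\<in>growth_words r k. \<kappa> k (reparam W a) = c" by blast
    show ?case
    proof (cases "r \<le> n")
      case False then show ?thesis using W by (intro exI[of _ W]) (auto simp: less_Suc_eq)
    next
      case True
      have "finite (range (\<lambda>a. \<kappa> n (reparam W a)))" by (rule finite_subset[OF _ fin[of n]]) auto
      from carlson_simpson[OF r True this] obtain V c where V: "rigid V" "\<And>i. i < r \<Longrightarrow> V i = i"
        and c: "\<And>a. a \<in> growth_words r n \<Longrightarrow> \<kappa> n (reparam W (reparam V a)) = c" by blast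
      have "\<exists>c. \<forall>a\<in>growth_words r k. \<kappa> k (reparam (V \<circ> W) a) = c" if "k < Suc n" "r \<le> k" for k
      proof (cases "k = n")
        case True then show ?thesis using c by (auto simp: reparam_comp V(1) W(1))
      next
        case False
        then have "k < n" using \<open>k < Suc n\<close> by simp
        then obtain c where "\<forall>a\<in>growth_words r k. \<kappa> k (reparam W a) = c" using W(3)[OF _ \<open>r \<le> k\<close>] by blast
        then show ?thesis using reparam_growth_words[OF V, where k = k] by (auto simp: reparam_comp V(1) W(1))
      qed
      moreover have "rigid (V \<circ> W)" "\<forall>i<r. (V \<circ> W) i = i" using V W by (auto intro: rigid_comp)
      ultimately show ?thesis by blast
    qed
  qed
  from this[of "Suc K"] obtain W where W: "rigid W"
    "\<And>k. k \<le> K \<Longrightarrow> r \<le> k \<Longrightarrow> \<exists>c. \<forall>a\<in>growth_words r k. \<kappa> k (reparam W a) = c"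
    by (auto simp: less_Suc_eq_le)
  then obtain c where "\<forall>k\<le>K. r \<le> k \<longrightarrow> (\<forall>a\<in>growth_words r k. \<kappa> k (reparam W a) = c k)" by metis
  then show ?thesis using W(1) by blast
qed

section \<open>From finite families of words to single words\<close>

lemma enumerate_by_first_occurrence:
  obtains a ds where "restricted_growth a" "distinct ds" "set ds = set cs" "set a = {..<length ds}"
    "cs = map ((!) ds) a"
proof -
  have "\<exists>a ds. restricted_growth a \<and> distinct ds \<and> set ds = set cs \<and> set a = {..<length ds} \<and> cs = map ((!) ds) a"
  proof (induction cs rule: rev_induct)
    case Nil show ?case by (intro exI[of _ "[]"]) (simp add: restricted_growth_def)
  next
    case (snoc c cs)
    then obtain a ds where IH: "restricted_growth a" "distinct ds" "set ds = set cs" "set a = {..<length ds}"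
      "cs = map ((!) ds) a" by blast
    have rg: "restricted_growth (a @ [x])" if "x \<le> length ds" for x
      unfolding restricted_growth_def
    proof (intro allI impI)
      fix i j assume i: "i < length (a @ [x])" "j < (a @ [x]) ! i"
      show "\<exists>i'<i. (a @ [x]) ! i' = j"
      proof (cases "i < length a")
        case True
        then obtain i' where "i' < i" "a ! i' = j" using IH(1) i by (auto simp: restricted_growth_def nth_append)
        then show ?thesis using True by (auto simp: nth_append intro!: exI[of _ i'])
      next
        case False
        then have "i = length a" using i by simp
        moreover from this have "j < length ds" using i that by simp
        moreover from this obtain i' where "i' < length a" "a ! i' = j"
          using IH(4) by (metis in_set_conv_nth lessThan_iff)
        ultimately show ?thesis by (auto simp: nth_append intro!: exI[of _ i'])
      qed
    qed
    show ?case
    proof (cases "c \<in> set ds")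
      case True
      then obtain x where "x < length ds" "ds ! x = c" by (metis in_set_conv_nth)
      then show ?thesis using IH rg[of x] True
        by (intro exI[of _ "a @ [x]"] exI[of _ ds]) auto
    next
      case False
      have "map ((!) (ds @ [c])) a = map ((!) ds) a" by (rule map_nth_prefix) (simp add: IH)
      then show ?thesis using IH rg[of "length ds"] False
        by (intro exI[of _ "a @ [length ds]"] exI[of _ "ds @ [c]"]) auto
    qed
  qed
  then show ?thesis using that by blast
qed

text \<open>A family of words is read column by column; the columns in order of first occurrence
  become the letters of a word \<open>a\<close>. The entry \<open>r\<close> marks that a word has already ended.\<close>

lemma envelope:
  fixes X :: "'m \<Rightarrow> nat list"
  assumes M: "finite M" "M \<noteq> {}"
    and X: "\<And>m. m \<in> M \<Longrightarrow> set (X m) \<subseteq> {..<r}" "\<And>m. m \<in> M \<Longrightarrow> take r (X m) = [0..<r]"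
  obtains k a Y where "r \<le> k" "k \<le> Suc r ^ card M" "a \<in> growth_words r k"
    "Y \<in> M \<rightarrow>\<^sub>E {y. set y \<subseteq> {..<r} \<and> length y \<le> k}" "\<And>m. m \<in> M \<Longrightarrow> X m = inst_word a (Y m)"
proof -
  define N where "N = Max ((\<lambda>m. length (X m)) ` M)"
  have N: "length (X m) \<le> N" if "m \<in> M" for m using M that by (auto simp: N_def)
  have rX: "r \<le> length (X m)" if "m \<in> M" for m
    using arg_cong[OF X(2)[OF that], of length] by simp
  have rN: "r \<le> N" using M rX N by (meson all_not_in_conv le_trans)
  define col where "col i = (\<lambda>m\<in>M. if i < length (X m) then X m ! i else r)" for i
  obtain a ds where a: "restricted_growth a" "distinct ds" "set ds = set (map col [0..<N])" "set a = {..<length ds}"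
    "map col [0..<N] = map ((!) ds) a"
    using enumerate_by_first_occurrence by blast
  define k where "k = length ds"
  have la: "length a = N" using arg_cong[OF a(5), of length] by simp
  have ds: "ds ! (a ! i) = col i" if "i < N" for i
    using arg_cong[OF a(5), of "\<lambda>l. l ! i"] that la by simp
  have Xr: "X m ! i < r" if "m \<in> M" "i < length (X m)" for m i
    using X(1)[OF that(1)] nth_mem[OF that(2)] by auto
  have "set ds \<subseteq> M \<rightarrow>\<^sub>E {..r}"
  proof
    fix c assume "c \<in> set ds"
    then obtain i where "c = col i" unfolding a(3) by auto
    then show "c \<in> M \<rightarrow>\<^sub>E {..r}" using Xr[of _ i] by (auto simp: col_def less_imp_le)
  qed
  then have "card (set ds) \<le> card (M \<rightarrow>\<^sub>E {..r})" by (intro card_mono finite_PiE) (auto simp: M)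
  then have kK: "k \<le> Suc r ^ card M"
    using M a(2) by (simp add: card_PiE distinct_card k_def)
  have col_r: "col i m = i" if "i < r" "m \<in> M" for i m
    using that rX[OF that(2)] X(2)[OF that(2)] by (auto simp: col_def) (metis add_0 nth_take nth_upt)
  \<comment> \<open>All words start with \<open>[0..<r]\<close>, so the first \<open>r\<close>
    columns are the distinct constant functions 0 to \<open>r - 1\<close> and are enumerated in this
    order.\<close>
  have ai: "a ! i = i" if "i < r" for i
    using that
  proof (induction i rule: less_induct)
    case (less i)
    obtain m where m: "m \<in> M" using M by auto
    have lt: "\<not> a ! i < i"
    proof
      assume *: "a ! i < i"
      then have "a ! (a ! i) = a ! i" using less by auto
      then have "col (a ! i) m = col i m" using ds[of i] ds[of "a ! i"] * less.prems rN by simp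
      then show False using col_r[of "a ! i" m] col_r[of i m] * less.prems m by simp
    qed
    have "\<not> i < a ! i"
    proof
      assume "i < a ! i"
      then obtain i' where "i' < i" "a ! i' = i" using a(1) less.prems rN la
        unfolding restricted_growth_def by (metis less_le_trans)
      then show False using less.IH[of i'] less.prems by simp
    qed
    with lt show ?case by simp
  qed
  have "take r a = [0..<r]" by (rule nth_equalityI) (use la rN ai in auto)
  then have a_growth: "a \<in> growth_words r k" using a by (simp add: growth_words_def k_def)
  have "r \<le> k"
  proof -
    have "{..<r} \<subseteq> {..<k}"
    proof (rule subsetI)
      fix i assume "i \<in> {..<r}"
      then have "a ! i = i" "i < length a" using ai la rN by auto
      then have "i \<in> set a" by (metis nth_mem)
      then show "i \<in> {..<k}" using a by (simp add: k_def)
    qed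
    then show ?thesis by auto
  qed
  \<comment> \<open>Row \<open>m\<close> of the list of distinct columns, cut at the first column in
    which \<open>m\<close> has ended; \<open>low\<close> and \<open>high\<close> show that this cut
    reproduces the end of \<open>X m\<close>.\<close>
  define Y where "Y = (\<lambda>m\<in>M. map (\<lambda>c. c m) (takeWhile (\<lambda>c. c m \<noteq> r) ds))"
  have "Y \<in> M \<rightarrow>\<^sub>E {y. set y \<subseteq> {..<r} \<and> length y \<le> k}"
  proof -
    have "c m < r" if "m \<in> M" "c \<in> set ds" "c m \<noteq> r" for c m
      using that Xr unfolding a(3) by (auto simp: col_def split: if_splits)
    then show ?thesis
      by (auto simp: Y_def k_def length_takeWhile_le dest!: set_takeWhileD)
  qed
  moreover have "X m = inst_word a (Y m)" if m: "m \<in> M" for m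
  proof -
    let ?t = "takeWhile (\<lambda>c. c m \<noteq> r) ds" and ?l = "length (X m)"
    have Ym: "Y m = map (\<lambda>c. c m) ?t" "length (Y m) = length ?t" using m by (auto simp: Y_def)
    \<comment> \<open>Otherwise the column numbered \<open>length ?t\<close>, in which
      \<open>m\<close> has ended, would by restricted growth occur at a position at most
      \<open>i\<close>, where \<open>X m\<close> is still running.\<close>
    have low: "a ! i < length ?t" if i: "i < ?l" for i
    proof (rule ccontr)
      assume "\<not> a ! i < length ?t"
      moreover have iN: "i < N" using i N[OF m] by simp
      moreover have aik: "a ! i < length ds" using a(4) la iN nth_mem[of i a] by auto
      ultimately have t: "length ?t < length ds" "length ?t \<le> a ! i" by auto
      then have "(ds ! length ?t) m = r" using nth_length_takeWhile[of "\<lambda>c. c m \<noteq> r" ds] by auto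
      moreover obtain i' where "i' \<le> i" "a ! i' = length ?t"
        using a(1) t(2) la iN unfolding restricted_growth_def by (metis le_eq_less_or_eq)
      ultimately have "col i' m = r" "i' < ?l" using ds[of i'] iN i by auto
      then show False using Xr[OF m, of i'] m by (simp add: col_def)
    qed
    have val: "Y m ! (a ! i) = X m ! i" if i: "i < ?l" for i
    proof -
      have "Y m ! (a ! i) = (ds ! (a ! i)) m"
        using low[OF i] by (simp add: Ym(1) takeWhile_nth)
      then show ?thesis using ds[of i] N[OF m] i m by (simp add: col_def)
    qed
    have high: "\<not> a ! ?l < length ?t" if "?l < N"
    proof
      assume *: "a ! ?l < length ?t"
      have "ds ! (a ! ?l) \<in> set ?t" using * by (metis nth_mem takeWhile_nth)
      then have "(ds ! (a ! ?l)) m \<noteq> r" by (auto dest: set_takeWhileD)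
      then show False using ds[OF that] m by (simp add: col_def)
    qed
    have "takeWhile (\<lambda>i. i < length (Y m)) a = take ?l a"
    proof (rule takeWhile_eq_take_P_nth)
      show "a ! i < length (Y m)" if "i < ?l" "i < length a" for i using low[OF that(1)] Ym by simp
      show "\<not> a ! ?l < length (Y m)" if "?l < length a" using high that la Ym by simp
    qed
    then have "inst_word a (Y m) = map ((!) (Y m)) (take ?l a)" by (simp add: inst_word_def)
    also have "\<dots> = X m" by (rule nth_equalityI) (use N[OF m] la val in auto)
    finally show ?thesis by simp
  qed
  ultimately show ?thesis using that[OF \<open>r \<le> k\<close> kK a_growth] by blast
qed

section \<open>Compact distance sets\<close>

locale compact_distances =
  fixes S :: "real set"
  assumes compact_S: "compact_distance_set S" and num_blocks: "num_blocks S \<ge> 2"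
begin

definition s1 :: real where "s1 = Min (S - {0})"

text \<open>On nonzero distances compactness identifies this relation with lying in the same
  block.\<close>

definition close :: "real \<Rightarrow> real \<Rightarrow> bool" where "close x y \<longleftrightarrow> \<bar>x - y\<bar> \<le> s1"

lemma finite_S: "finite S" and zero_S: "0 \<in> S" and nonneg_S: "x \<in> S \<Longrightarrow> 0 \<le> x"
  using compact_S by (auto simp: compact_distance_set_def distance_set_def)

lemma jump_numbers_subset: "jump_numbers S \<subseteq> S"
  by (auto simp: jump_numbers_def)

lemma finite_jump_numbers: "finite (jump_numbers S)"
  using finite_S jump_numbers_subset by (rule rev_finite_subset)

lemma Max_S: "Max S \<in> S"
  using finite_S zero_S by (intro Max_in) auto

lemma Max_jump: "Max S \<in> jump_numbers S"
  using Max_S by (simp add: jump_numbers_def)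

lemma card_jump_numbers: "card (jump_numbers S) = Suc (num_blocks S)"
  using num_blocks by (auto simp: num_blocks_def)

lemma jump_less: "i < j \<Longrightarrow> j \<le> num_blocks S \<Longrightarrow> jump S i < jump S j"
  unfolding jump_def
  by (rule sorted_wrt_nth_less[OF strict_sorted_list_of_set]) (auto simp: card_jump_numbers)

lemma jump_in: "i \<le> num_blocks S \<Longrightarrow> jump S i \<in> jump_numbers S"
  unfolding jump_def using finite_jump_numbers
  by (metis card_jump_numbers le_imp_less_Suc nth_mem set_sorted_list_of_set sorted_list_of_set.length_sorted_key_list_of_set)

lemma jump_ex: "x \<in> jump_numbers S \<Longrightarrow> \<exists>i\<le>num_blocks S. jump S i = x"
  unfolding jump_def using finite_jump_numbers
  by (metis card_jump_numbers in_set_conv_nth less_Suc_eq_le set_sorted_list_of_set sorted_list_of_set.length_sorted_key_list_of_set)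

lemma zero_jump: "0 \<in> jump_numbers S"
proof (cases "0 = Max S")
  case False
  then have "Max S > 0" using nonneg_S[OF Max_S] by simp
  then have "Max S \<in> {y \<in> S. 0 < y}" using Max_S by simp
  then have "Min {y \<in> S. 0 < y} \<in> {y \<in> S. 0 < y}" using finite_S by (intro Min_in) auto
  then show ?thesis using zero_S by (simp add: jump_numbers_def)
qed (use Max_jump in simp)

lemma jump_0: "jump S 0 = 0"
proof -
  obtain i where i: "i \<le> num_blocks S" "jump S i = 0" using jump_ex[OF zero_jump] by blast
  have "0 \<le> jump S 0" using jump_in[of 0] jump_numbers_subset nonneg_S by auto
  then show ?thesis using jump_less[of 0 i] i by (cases "i = 0") auto
qed

lemma block_subset: "block S i \<subseteq> S"
  using zero_S by (auto simp: block_def)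

lemma jump_mono: "i \<le> j \<Longrightarrow> j \<le> num_blocks S \<Longrightarrow> jump S i \<le> jump S j"
  using jump_less[of i j] by (cases "i = j") auto

lemma block_less:
  assumes "i < j" "j \<le> num_blocks S" "x \<in> block S i" "y \<in> block S j"
  shows "x < y"
proof -
  have "x \<le> jump S i" using assms(3) by (auto simp: block_def jump_0 split: if_splits)
  also have "\<dots> \<le> jump S (j - 1)" using assms by (intro jump_mono) auto
  also have "\<dots> < y" using assms by (auto simp: block_def)
  finally show ?thesis .
qed

lemma block_unique:
  assumes "i \<le> num_blocks S" "j \<le> num_blocks S" "x \<in> block S i" "x \<in> block S j"
  shows "i = j"
  using block_less[of i j x x] block_less[of j i x x] assms by (cases i j rule: linorder_cases) auto

lemma close_iff_same_block:
  "x \<in> S - {0} \<Longrightarrow> y \<in> S - {0} \<Longrightarrow> close x y \<longleftrightarrow> same_block S x y"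
  using compact_S unfolding compact_distance_set_def close_def s1_def by blast

lemma close_sym: "close x y \<longleftrightarrow> close y x"
  by (auto simp: close_def)

lemma close_trans:
  assumes "x \<in> S - {0}" "y \<in> S - {0}" "z \<in> S - {0}" "close x y" "close y z"
  shows "close x z"
proof -
  have "same_block S x y" "same_block S y z" using assms by (auto simp: close_iff_same_block)
  then have "same_block S x z" unfolding same_block_def using block_unique by metis
  then show ?thesis using assms by (simp add: close_iff_same_block)
qed

text \<open>The block of \<open>x\<close> ends at the least jump number \<open>J \<ge> x\<close>. A
  larger \<open>y\<close> from another block lies beyond \<open>J\<close>, and so beyond
  \<open>2 * J\<close>.\<close>

lemma not_close_double:
  assumes x: "x \<in> S - {0}" and y: "y \<in> S - {0}" and "x < y" "\<not> close x y"
  shows "2 * x < y"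
proof -
  define J where "J = Min {j \<in> jump_numbers S. x \<le> j}"
  have ne: "Max S \<in> {j \<in> jump_numbers S. x \<le> j}" using Max_jump x finite_S by auto
  then have J: "J \<in> {j \<in> jump_numbers S. x \<le> j}"
    unfolding J_def using finite_jump_numbers by (intro Min_in) auto
  obtain i where i: "i \<le> num_blocks S" "jump S i = J" using jump_ex[of J] J by auto
  have "0 < x" using x nonneg_S[of x] by auto
  then have "i \<noteq> 0" using i J jump_0 by (intro notI) auto
  have "jump S (i - 1) < x"
  proof (rule ccontr)
    assume "\<not> jump S (i - 1) < x"
    then have "J \<le> jump S (i - 1)"
      unfolding J_def using finite_jump_numbers jump_in[of "i - 1"] i by (intro Min_le) auto
    then show False using jump_less[of "i - 1" i] i \<open>i \<noteq> 0\<close> by auto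
  qed
  have "\<not> y \<le> J"
  proof
    assume "y \<le> J"
    then have "x \<in> block S i" "y \<in> block S i"
      using x y J i \<open>i \<noteq> 0\<close> \<open>jump S (i - 1) < x\<close> \<open>x < y\<close> by (auto simp: block_def)
    then have "same_block S x y" using i by (auto simp: same_block_def)
    then show False using assms by (simp add: close_iff_same_block)
  qed
  then have "J < y" by simp
  moreover have "y \<le> Max S" using y finite_S by auto
  ultimately have "2 * J < Min {z \<in> S. J < z}" using J by (auto simp: jump_numbers_def)
  also have "\<dots> \<le> y" using y finite_S \<open>J < y\<close> by (intro Min_le) auto
  finally show ?thesis using J by auto
qed

lemma s1_in: "s1 \<in> S - {0}"
proof -
  have "jump S 1 \<in> S - {0}"
    using jump_in[of 1] jump_less[of 0 1] num_blocks jump_numbers_subset jump_0 by auto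
  then show ?thesis unfolding s1_def using finite_S by (intro Min_in) auto
qed

lemma s1_le: "x \<in> S - {0} \<Longrightarrow> s1 \<le> x"
  unfolding s1_def using finite_S by (intro Min_le) auto

lemma s1_pos: "0 < s1"
  using s1_in nonneg_S[of s1] by auto

lemma close_refl: "close x x"
  using s1_pos by (simp add: close_def)

lemma close_s1: "x \<in> S - {0} \<Longrightarrow> close x s1 \<longleftrightarrow> x \<le> 2 * s1"
  using s1_le[of x] by (auto simp: close_def)

lemma s1_block: "s1 \<in> block S 1"
proof -
  have "jump S 1 \<in> S - {0}"
    using jump_in[of 1] jump_less[of 0 1] num_blocks jump_numbers_subset jump_0 by auto
  then show ?thesis using s1_le s1_in s1_pos by (auto simp: block_def jump_0)
qed

text \<open>For nonzero distances \<open>close x s1\<close> amounts to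
  \<open>x \<le> 2 * s1\<close>, which turns \<open>near\<close> into a plain distance
  bound.\<close>

lemma block_1: "{0} \<union> block S 1 = {x \<in> S. x \<le> 2 * s1}"
proof -
  have "x \<in> block S 1 \<longleftrightarrow> x \<le> 2 * s1" if x: "x \<in> S - {0}" for x
  proof -
    have "x \<le> 2 * s1 \<longleftrightarrow> same_block S x s1"
      using close_s1[OF x] close_iff_same_block[OF x s1_in] by simp
    also have "\<dots> \<longleftrightarrow> x \<in> block S 1"
      using s1_block num_blocks block_unique[of _ 1 s1] unfolding same_block_def
      by (metis one_le_numeral order.trans)
    finally show ?thesis by simp
  qed
  moreover have "0 \<notin> block S 1" using jump_0 by (simp add: block_def)
  ultimately show ?thesis using block_subset[of 1] zero_S s1_pos by fastforce
qed

text \<open>If \<open>q' + r' < p'\<close>, then \<open>p'\<close> exceeds both \<open>q'\<close>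
  and \<open>r'\<close> by more than \<open>s1\<close>, as nonzero distances are at least
  \<open>s1\<close>. So \<open>p'\<close> lies in a higher block than either, and likewise
  \<open>p\<close>; then \<open>2 * q < p\<close> and \<open>2 * r < p\<close> contradict
  \<open>p \<le> q + r\<close>.\<close>

lemma close_triangle:
  assumes S: "p \<in> S - {0}" "q \<in> S - {0}" "r \<in> S - {0}" "p' \<in> S - {0}" "q' \<in> S - {0}" "r' \<in> S - {0}"
    and c: "close p p'" "close q q'" "close r r'" and tri: "p \<le> q + r"
  shows "p' \<le> q' + r'"
proof (rule ccontr)
  assume "\<not> p' \<le> q' + r'"
  then have gt: "q' + r' < p'" by simp
  have ge_s1: "s1 \<le> p" "s1 \<le> q" "s1 \<le> r" "s1 \<le> p'" "s1 \<le> q'" "s1 \<le> r'" using S s1_le by blast+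
  have "2 * x < p" if x: "x \<in> S - {0}" "x' \<in> S - {0}" "close x x'" "x' + s1 < p'" for x x'
  proof -
    have nc: "\<not> close p' x'" using that by (auto simp: close_def)
    have nc': "\<not> close x p"
    proof
      assume "close x p"
      then have "close x p'" using close_trans x S c by blast
      then have "close x' p'" using close_trans x S close_sym by blast
      then show False using nc close_sym by blast
    qed
    moreover have "x < p"
    proof (rule ccontr)
      assume "\<not> x < p"
      then have "p < x" using nc' close_refl by (cases "x = p") auto
      then have "2 * p < x" using not_close_double[of p x] nc' x S close_sym by blast
      then have "p' \<le> x" using c(1) ge_s1 by (auto simp: close_def)
      then have "close x p'" using x(3,4) s1_pos by (auto simp: close_def)
      then have "close x p" using close_trans[of x p' p] x S c close_sym by blast
      then show False using nc' by simp
    qed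
    ultimately show ?thesis using not_close_double x S by blast
  qed
  from this[of q q'] this[of r r'] have "2 * q < p" "2 * r < p" using S c gt ge_s1 s1_pos by auto
  then show False using tri by simp
qed

text \<open>A \<open>p\<close> outside the first block would be more than twice \<open>q\<close> and
  more than twice \<open>r\<close>.\<close>

lemma near_trans:
  assumes S: "p \<in> S" "q \<in> S" "r \<in> S" and "q \<le> 2 * s1" "r \<le> 2 * s1" "p \<le> q + r"
  shows "p \<le> 2 * s1"
proof (rule ccontr)
  assume "\<not> p \<le> 2 * s1"
  moreover have "q \<noteq> 0" "r \<noteq> 0" "p \<noteq> 0" using calculation assms s1_pos by auto
  ultimately have nz: "p \<in> S - {0}" "q \<in> S - {0}" "r \<in> S - {0}" using S by auto
  have "2 * x < p" if "x \<in> S - {0}" "x \<le> 2 * s1" for x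
  proof -
    have "\<not> close x p"
      using close_trans[of p x s1] close_s1[OF that(1)] close_s1[OF nz(1)] that nz s1_in close_sym
        \<open>\<not> p \<le> 2 * s1\<close> by blast
    then show ?thesis using not_close_double[of x p] that nz \<open>\<not> p \<le> 2 * s1\<close> by auto
  qed
  from this[OF nz(2)] this[OF nz(3)] show False using assms by simp
qed

end

section \<open>Blocks of distances between near-classes\<close>

locale S_metric_space = compact_distances S for S +
  fixes U :: "'c metric"
  assumes U_Met: "U \<in> Met S"
begin

abbreviation d :: "'c \<Rightarrow> 'c \<Rightarrow> real" where "d \<equiv> mdist U"

lemma d_S: "x \<in> mspace U \<Longrightarrow> y \<in> mspace U \<Longrightarrow> d x y \<in> S"
  using U_Met by (auto simp: Met_def)

lemma d_S': "x \<in> mspace U \<Longrightarrow> y \<in> mspace U \<Longrightarrow> x \<noteq> y \<Longrightarrow> d x y \<in> S - {0}"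
  using d_S by auto

lemma near_iff: "(x, y) \<in> near S U \<longleftrightarrow> x \<in> mspace U \<and> y \<in> mspace U \<and> d x y \<le> 2 * s1"
  unfolding near_def block_1 using d_S by auto

lemma d_self [simp]: "x \<in> mspace U \<Longrightarrow> d x x = 0"
  by simp

lemma near_refl: "x \<in> mspace U \<Longrightarrow> d x x \<le> 2 * s1"
  using s1_pos by simp

lemma d_near_trans:
  "\<lbrakk>x \<in> mspace U; y \<in> mspace U; z \<in> mspace U; d x y \<le> 2 * s1; d y z \<le> 2 * s1\<rbrakk> \<Longrightarrow> d x z \<le> 2 * s1"
  using near_trans[of "d x z" "d x y" "d y z"] d_S mdist_triangle[of x U y z] by blast

lemma equiv_near: "equiv (mspace U) (near S U)"
proof (rule equivI)
  show "near S U \<subseteq> mspace U \<times> mspace U" by (auto simp: near_iff)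
  show "refl_on (mspace U) (near S U)" using near_refl by (auto simp: refl_on_def near_iff)
  show "sym (near S U)" by (auto simp: sym_def near_iff mdist_commute)
  show "trans (near S U)" using d_near_trans by (auto simp: trans_def near_iff)
qed

text \<open>\<open>dd x y\<close> represents the block from which all distances between the classes of \<open>x\<close> and \<open>y\<close> are
  taken, hence the value \<open>s1\<close> on the diagonal.\<close>

definition dd :: "'c \<Rightarrow> 'c \<Rightarrow> real" where "dd x y = (if x = y then s1 else d x y)"

lemma dd_S: "x \<in> mspace U \<Longrightarrow> y \<in> mspace U \<Longrightarrow> dd x y \<in> S - {0}"
  using d_S' s1_in by (auto simp: dd_def)

lemma dd_commute: "dd x y = dd y x"
  by (auto simp: dd_def mdist_commute)

lemma dd_near: "x \<in> mspace U \<Longrightarrow> y \<in> mspace U \<Longrightarrow> dd x y \<le> 2 * s1 \<longleftrightarrow> d x y \<le> 2 * s1"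
  using s1_pos near_refl by (auto simp: dd_def)

lemma dd_triangle:
  "\<lbrakk>x \<in> mspace U; y \<in> mspace U; z \<in> mspace U\<rbrakk> \<Longrightarrow> dd x z \<le> dd x y + dd y z"
  using mdist_triangle[of x U y z] s1_pos dd_S[of x y] dd_S[of y z] s1_le[of "dd x y"] s1_le[of "dd y z"]
  by (auto simp: dd_def)

text \<open>If the smaller value lay in a lower block, it would be less than half the larger and
  hence, by the triangle inequality, below \<open>dd b b' \<le> 2 * s1\<close>. But then both
  \<open>b\<close> and \<open>b'\<close> are near \<open>a\<close>, and both values lie in the first
  block.\<close>

lemma close_dd:
  assumes U: "a \<in> mspace U" "b \<in> mspace U" "b' \<in> mspace U" and n: "d b b' \<le> 2 * s1"
  shows "close (dd a b) (dd a b')"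
proof (rule ccontr)
  assume nc: "\<not> close (dd a b) (dd a b')"
  have "False" if bb: "b \<in> mspace U" "b' \<in> mspace U" "d b b' \<le> 2 * s1"
    and nc: "\<not> close (dd a b) (dd a b')" and lt: "dd a b < dd a b'" for b b'
  proof -
    have "2 * dd a b < dd a b'" using not_close_double dd_S U bb nc lt by blast
    moreover have "dd a b' \<le> dd a b + dd b b'" by (rule dd_triangle) (use U bb in auto)
    moreover have "dd b b' \<le> 2 * s1" using bb dd_near by blast
    ultimately have "dd a b \<le> 2 * s1" by simp
    moreover from this have "d a b' \<le> 2 * s1"
      using d_near_trans[of a b b'] dd_near U bb by blast
    then have "dd a b' \<le> 2 * s1" using dd_near U bb by blast
    ultimately have "close (dd a b) s1" "close s1 (dd a b')"
      using close_s1 dd_S U bb close_sym by blast+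
    then show False using close_trans[of "dd a b" s1 "dd a b'"] dd_S U bb s1_in nc by blast
  qed
  from this[of b b'] this[of b' b] show False
    using nc U n close_sym close_refl mdist_commute[of U] by (metis linorder_less_linear)
qed

end

lemma (in compact_distances) spansI:
  fixes A :: "'e metric" and L :: "'b metric"
  assumes A: "A \<in> Met S" and T: "T \<subseteq> mspace A" "isometric (submetric A T) L" "finite T"
    and rep: "\<And>x. x \<in> mspace A \<Longrightarrow> \<exists>!t. t \<in> T \<and> mdist A x t \<le> 2 * s1"
  shows "spans S L A"
proof -
  interpret A: S_metric_space S A by unfold_locales (rule A)
  have cls: "\<exists>!t. t \<in> T \<inter> near S A `` {x}" if "x \<in> mspace A" for x
    using rep[OF that] that T(1) by (auto simp: A.near_iff)
  have q: "mspace A // near S A = (\<lambda>t. near S A `` {t}) ` T"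
  proof
    show "mspace A // near S A \<subseteq> (\<lambda>t. near S A `` {t}) ` T"
    proof
      fix X assume "X \<in> mspace A // near S A"
      then obtain x where x: "x \<in> mspace A" "X = near S A `` {x}" by (auto simp: quotient_def)
      then obtain t where "t \<in> T" "(x, t) \<in> near S A" using cls[of x] by auto
      then show "X \<in> (\<lambda>t. near S A `` {t}) ` T"
        using x equiv_class_eq[OF A.equiv_near] by auto
    qed
    show "(\<lambda>t. near S A `` {t}) ` T \<subseteq> mspace A // near S A"
      using T(1) by (auto intro: quotientI)
  qed
  have "inj_on (\<lambda>t. near S A `` {t}) T"
  proof (rule inj_onI)
    fix t u assume tu: "t \<in> T" "u \<in> T" "near S A `` {t} = near S A `` {u}"
    then have "(t, u) \<in> near S A"
      using eq_equiv_class[OF _ A.equiv_near] T(1) by blast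
    moreover have "(t, t) \<in> near S A" using tu T(1) A.near_refl by (auto simp: A.near_iff)
    ultimately show "t = u" using cls[of t] tu T(1) by auto
  qed
  then have "card (mspace A // near S A) = card T" by (simp add: q card_image)
  also have "\<dots> = card (mspace L)"
    using T(1,2) by (auto simp: isometric_def isometries_def Int_absorb2 dest!: bij_betw_same_card)
  finally have "card (mspace A // near S A) = card (mspace L)" .
  moreover have "finite (mspace A // near S A)" using q T(3) by simp
  moreover have "\<forall>X\<in>mspace A // near S A. \<exists>!a. a \<in> T \<inter> X"
    using cls by (auto simp: quotient_def)
  ultimately show ?thesis unfolding spans_def using T(1,2) by (intro conjI exI[of _ T])
qed

lemma (in S_metric_space) spansD:
  fixes L :: "'b metric"
  assumes "spans S L U" "finite (mspace L)"
  shows "\<exists>T. T \<subseteq> mspace U \<and> finite T \<and> isometric (submetric U T) L \<and>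
    (\<forall>x\<in>mspace U. \<exists>!t. t \<in> T \<and> d x t \<le> 2 * s1)"
proof -
  obtain T where T: "T \<subseteq> mspace U" "\<forall>X\<in>mspace U // near S U. \<exists>!a. a \<in> T \<inter> X"
    "isometric (submetric U T) L"
    using assms by (auto simp: spans_def)
  have "finite T"
    using T assms(2) by (auto simp: isometric_def isometries_def Int_absorb2 dest!: bij_betw_finite)
  moreover have "\<exists>!t. t \<in> T \<and> d x t \<le> 2 * s1" if "x \<in> mspace U" for x
  proof -
    have "\<exists>!t. t \<in> T \<inter> near S U `` {x}" using T(2) quotientI[OF that, of "near S U"] by (rule bspec)
    moreover have "t \<in> T \<inter> near S U `` {x} \<longleftrightarrow> t \<in> T \<and> d x t \<le> 2 * s1" for t
      using T(1) that by (auto simp: near_iff)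
    ultimately show ?thesis by simp
  qed
  ultimately show ?thesis using T(1,3) by (intro exI[of _ T] conjI ballI)
qed

section \<open>The limit space\<close>

locale limit_space = S_metric_space S U for S and U :: "'c metric" +
  fixes L :: "'b metric"
  assumes finite_L: "finite (mspace L)" and limit: "fraisse_limit S L U"
begin

lemma transversal:
  "\<exists>T. T \<subseteq> mspace U \<and> finite T \<and> isometric (submetric U T) L \<and>
    (\<forall>x\<in>mspace U. \<exists>!t. t \<in> T \<and> d x t \<le> 2 * s1)"
proof -
  have "spans S L U" using limit by (simp add: fraisse_limit_def Met_spanned_def)
  then show ?thesis using finite_L by (rule spansD)
qed

lemma embedding_of_fin_Met_spanned:
  assumes "A \<in> fin_Met_spanned S L"
  obtains h where "h \<in> embeddings A U"
  using limit assms by (auto simp: fraisse_limit_def age_def)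

lemma isometry_extending:
  assumes "A \<in> fin_Met_spanned S L" "f \<in> embeddings A U" "g \<in> embeddings A U"
  shows "\<exists>h\<in>isometries U U. f = compose (mspace A) h g"
  using limit assms unfolding fraisse_limit_def ultrahomogeneous_def by blast

text \<open>The new point plays the role of \<open>a0\<close>, and distances in the same blocks cannot violate the
  triangle inequality. The transversal is added so that the finite spaces belong to the class for
  which ultrahomogeneity is available.\<close>

lemma extension:
  assumes F: "finite F" "F \<subseteq> mspace U" and a0: "a0 \<in> mspace U"
    and g: "\<And>x. x \<in> F \<Longrightarrow> g x \<in> S - {0}" "\<And>x. x \<in> F \<Longrightarrow> close (g x) (dd a0 x)"
  shows "\<exists>y\<in>mspace U. d a0 y \<le> 2 * s1 \<and> (\<forall>x\<in>F. d y x = g x)"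
proof -
  obtain T where T: "T \<subseteq> mspace U" "finite T" "isometric (submetric U T) L"
    and rep: "\<forall>x\<in>mspace U. \<exists>!t. t \<in> T \<and> d x t \<le> 2 * s1"
    using transversal by blast
  \<comment> \<open>The point \<open>a0\<close> is included because its prescribed distance to the
    new point, \<open>s1\<close> unless \<open>g\<close> gives another value close to it, forces
    that point into the class of \<open>a0\<close>.\<close>
  define G where "G = insert a0 (F \<union> T)"
  have G: "finite G" "G \<subseteq> mspace U" using F T a0 by (auto simp: G_def)
  define g' where "g' x = (if x \<in> F then g x else dd a0 x)" for x
  have g': "g' x \<in> S - {0}" "close (g' x) (dd a0 x)" if "x \<in> mspace U" for x
    using g[of x] dd_S[OF a0 that] close_refl by (auto simp: g'_def)
  define N where "N = card G"
  obtain e0 where e0: "bij_betw e0 {..<N} G"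
    using ex_bij_betw_nat_finite[OF G(1)] by (auto simp: N_def atLeast0LessThan)
  \<comment> \<open>Index \<open>N\<close> is the new point. Sending it to \<open>a0\<close> gives
    every pair of indices a block \<open>dd (e i) (e j)\<close> to compare with, also where
    \<open>e\<close> repeats the value \<open>a0\<close>.\<close>
  define e where "e = e0(N := a0)"
  have e: "bij_betw e {..<N} G" using e0 by (auto simp: e_def intro: bij_betw_cong[THEN iffD1])
  have eN: "e N = a0" by (simp add: e_def)
  have eG: "e i \<in> G" if "i < N" for i using e that by (auto simp: bij_betw_def)
  have eU: "e i \<in> mspace U" if "i \<le> N" for i
    using eG[of i] eN a0 G that by (cases "i = N") auto
  have einj: "i = j" if "e i = e j" "i < N" "j < N" for i j
    using e that by (auto simp: bij_betw_def inj_on_def)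
  define D where "D i j = (if i = j then 0 else if i < N \<and> j < N then d (e i) (e j)
    else if i < N then g' (e i) else if j < N then g' (e j) else 0)" for i j
  have Dsym: "D i j = D j i" for i j by (auto simp: D_def mdist_commute)
  have D: "D i j \<in> S - {0} \<and> close (D i j) (dd (e i) (e j))" if "i \<le> N" "j \<le> N" "i \<noteq> j" for i j
  proof -
    have one: "D i j \<in> S - {0} \<and> close (D i j) (dd (e i) (e j))" if "i < j" "j \<le> N" for i j
    proof (cases "j = N")
      case True
      then show ?thesis using that g'[of "e i"] eU[of i] by (simp add: D_def eN dd_commute)
    next
      case False
      then have "D i j = dd (e i) (e j)"
        using that einj[of i j] by (auto simp: D_def dd_def)
      then show ?thesis using that dd_S[of "e i" "e j"] eU close_refl by simp
    qed
    show ?thesis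
      using one[of i j] one[of j i] that Dsym[of i j] dd_commute[of "e i" "e j"]
      by (cases i j rule: linorder_cases) auto
  qed
  have g'0: "0 \<le> g' (e i)" if "i < N" for i
    using g'(1)[OF eU[of i]] nonneg_S that by simp
  have D0: "0 \<le> D i j" for i j using g'0 by (simp add: D_def)
  have Dii: "D i i = 0" for i by (simp add: D_def)
  have Metr: "Metric_space {..N} D"
  proof
    show "0 \<le> D i j" "D i j = D j i" for i j using D0 Dsym by blast+
    show "D i j = 0 \<longleftrightarrow> i = j" if "i \<in> {..N}" "j \<in> {..N}" for i j
      using D[of i j] that by (cases "i = j") (auto simp: D_def)
    show "D i k \<le> D i j + D j k" if ijk: "i \<in> {..N}" "j \<in> {..N}" "k \<in> {..N}" for i j k
    proof (cases "i = j \<or> j = k \<or> i = k")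
      case True
      then show ?thesis using D0[of i j] D0[of j k] Dii[of i] Dii[of j] by (elim disjE) simp_all
    next
      case False
      have ijk': "e i \<in> mspace U" "e j \<in> mspace U" "e k \<in> mspace U" using ijk eU by auto
      have DS: "D i k \<in> S - {0}" "D i j \<in> S - {0}" "D j k \<in> S - {0}"
        using D[of i k] D[of i j] D[of j k] ijk False by simp_all
      have c: "close (dd (e i) (e k)) (D i k)" "close (dd (e i) (e j)) (D i j)"
        "close (dd (e j) (e k)) (D j k)"
        using D[of i k] D[of i j] D[of j k] ijk False by (simp_all add: close_sym)
      show ?thesis
        by (rule close_triangle[OF dd_S[OF ijk'(1,3)] dd_S[OF ijk'(1,2)] dd_S[OF ijk'(2,3)]
              DS c dd_triangle[OF ijk']])
    qed
  qed
  define A where "A = metric ({..N}, D)"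
  define A0 where "A0 = submetric A {..<N}"
  have A: "mspace A = {..N}" "mdist A = D"
    unfolding A_def by (simp_all add: Metric_space.mspace_metric[OF Metr] Metric_space.mdist_metric[OF Metr])
  have A0: "mspace A0 = {..<N}" "mdist A0 = D" by (auto simp: A0_def A)
  have DS: "D i j \<in> S" if "i \<le> N" "j \<le> N" for i j
    using D[OF that] zero_S by (cases "i = j") (auto simp: D_def)
  have Met: "A \<in> Met S" "A0 \<in> Met S" using DS by (auto simp: Met_def A A0)
  have Dd: "D i j = d (e i) (e j)" if "i < N" "j < N" for i j
    using that eU[of i] by (auto simp: D_def)
  define T' where "T' = {i \<in> {..<N}. e i \<in> T}"
  have eT: "bij_betw e T' T"
  proof -
    have "e ` T' = T"
    proof
      show "T \<subseteq> e ` T'"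
      proof
        fix t assume t: "t \<in> T"
        then have "t \<in> e ` {..<N}" using e by (auto simp: bij_betw_def G_def)
        then show "t \<in> e ` T'" using t by (auto simp: T'_def)
      qed
    qed (auto simp: T'_def)
    moreover have "inj_on e T'" using e by (auto simp: bij_betw_def T'_def inj_on_def)
    ultimately show ?thesis by (simp add: bij_betw_def)
  qed
  have T'N: "T' \<subseteq> {..<N}" by (auto simp: T'_def)
  have iso: "isometric (submetric A T') L"
  proof -
    obtain \<iota> where \<iota>: "\<iota> \<in> embeddings (submetric U T) L" "bij_betw \<iota> T (mspace L)"
      using T(1,3) by (auto simp: isometric_def isometries_def Int_absorb2)
    have bij: "bij_betw (restrict (\<iota> \<circ> e) T') T' (mspace L)"
      using bij_betw_trans[OF eT \<iota>(2)] by (simp add: bij_betw_restrict_eq)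
    have sp: "T' \<inter> {..N} = T'" using T'N by auto
    have "restrict (\<iota> \<circ> e) T' \<in> embeddings (submetric A T') L"
      unfolding embeddings_def
    proof (intro CollectI conjI ballI)
      show "restrict (\<iota> \<circ> e) T' \<in> mspace (submetric A T') \<rightarrow>\<^sub>E mspace L"
        using bij_betw_imp_funcset[OF bij_betw_trans[OF eT \<iota>(2)]] by (auto simp: A sp)
      fix i j assume "i \<in> mspace (submetric A T')" "j \<in> mspace (submetric A T')"
      then have ij: "i \<in> T'" "j \<in> T'" by auto
      then have "e i \<in> T" "e j \<in> T" "i < N" "j < N" by (auto simp: T'_def)
      then show "mdist L (restrict (\<iota> \<circ> e) T' i) (restrict (\<iota> \<circ> e) T' j) = mdist (submetric A T') i j"
        using ij \<iota>(1) T(1) by (auto simp: embeddings_def A Dd)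
    qed
    then have "restrict (\<iota> \<circ> e) T' \<in> isometries (submetric A T') L"
      using bij by (simp add: isometries_def A sp)
    then show ?thesis by (auto simp: isometric_def)
  qed
  have D_near: "D i j \<le> 2 * s1 \<longleftrightarrow> d (e i) (e j) \<le> 2 * s1" if ij: "i \<le> N" "j \<le> N" for i j
  proof (cases "i = j")
    case True
    then show ?thesis using near_refl[OF eU[of j]] ij s1_pos by (simp add: D_def)
  next
    case False
    have "D i j \<le> 2 * s1 \<longleftrightarrow> dd (e i) (e j) \<le> 2 * s1"
      using D[OF ij False] close_s1[of "D i j"] close_s1[OF dd_S[OF eU eU]] ij s1_in
        close_trans[of "D i j" "dd (e i) (e j)" s1] close_trans[of "dd (e i) (e j)" "D i j" s1]
        dd_S[OF eU eU] close_sym by blast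
    then show ?thesis using dd_near eU ij by blast
  qed
  have repA: "\<exists>!t. t \<in> T' \<and> D i t \<le> 2 * s1" if i: "i \<le> N" for i
  proof -
    obtain t where t: "t \<in> T" "d (e i) t \<le> 2 * s1"
      and uniq: "\<And>t'. t' \<in> T \<Longrightarrow> d (e i) t' \<le> 2 * s1 \<Longrightarrow> t' = t"
      using bspec[OF rep eU[OF i]] by (metis (no_types))
    obtain j where j: "j \<in> T'" "e j = t" using eT t(1) by (auto simp: bij_betw_def)
    have D_T': "D i j \<le> 2 * s1 \<longleftrightarrow> d (e i) (e j) \<le> 2 * s1" if "j \<in> T'" for j
      using D_near[OF i, of j] that T'N by auto
    show ?thesis
    proof (rule ex1I[of _ j])
      show "j \<in> T' \<and> D i j \<le> 2 * s1" using j t D_T' by simp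
      fix j' assume j': "j' \<in> T' \<and> D i j' \<le> 2 * s1"
      then have "e j' = t" using uniq[of "e j'"] D_T' by (auto simp: T'_def)
      then show "j' = j" using einj[of j' j] j j' by (auto simp: T'_def)
    qed
  qed
  have finT': "finite T'" by (simp add: T'_def)
  have "spans S L A"
    by (rule spansI[OF Met(1) _ iso finT']) (use T'N repA in \<open>auto simp: A\<close>)
  then have A_in: "A \<in> fin_Met_spanned S L" using Met by (simp add: fin_Met_spanned_def Met_spanned_def A)
  have iso0: "isometric (submetric A0 T') L"
    using iso T'N by (simp add: A0_def Int_absorb1)
  have "spans S L A0"
    by (rule spansI[OF Met(2) _ iso0 finT']) (use T'N repA in \<open>auto simp: A0\<close>)
  then have A0_in: "A0 \<in> fin_Met_spanned S L" using Met by (simp add: fin_Met_spanned_def Met_spanned_def A0)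
  obtain h where h: "h \<in> embeddings A U" using embedding_of_fin_Met_spanned[OF A_in] .
  have hU: "h i \<in> mspace U" if "i \<le> N" for i using h that by (auto simp: embeddings_def A)
  have hD: "d (h i) (h j) = D i j" if "i \<le> N" "j \<le> N" for i j
    using h that by (auto simp: embeddings_def A)
  \<comment> \<open>Ultrahomogeneity moves the copy of the old points under \<open>h\<close> back
    onto \<open>G\<close>; the image of \<open>h N\<close> is the required point.\<close>
  have "restrict e {..<N} \<in> embeddings A0 U" "restrict h {..<N} \<in> embeddings A0 U"
    using eU hU hD Dd by (auto simp: embeddings_def A0)
  then obtain w where w: "w \<in> isometries U U"
    and we: "restrict e {..<N} = compose (mspace A0) w (restrict h {..<N})"
    using isometry_extending[OF A0_in] by blast
  have we': "e i = w (h i)" if "i < N" for i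
    using fun_cong[OF we, of i] that by (simp add: compose_def A0)
  have wU: "w x \<in> mspace U" "d (w x) (w y) = d x y" if "x \<in> mspace U" "y \<in> mspace U" for x y
    using w that by (auto simp: isometries_def embeddings_def)
  define y where "y = w (h N)"
  have dy: "d y x = g' x" if xG: "x \<in> G" for x
  proof -
    obtain i where i: "i < N" "x = e i" using e xG by (auto simp: bij_betw_def)
    then have "d y x = D N i" using we' wU hU hD by (simp add: y_def)
    then show ?thesis using i by (simp add: D_def)
  qed
  have "y \<in> mspace U" using wU(1)[OF hU[OF order_refl] hU[OF order_refl]] by (simp add: y_def)
  moreover have "d a0 y \<le> 2 * s1"
    using dy[of a0] g'[OF a0] close_s1[of "g' a0"] mdist_commute[of U a0 y] by (simp add: G_def dd_def)
  moreover have "d y x = g x" if "x \<in> F" for x using dy[of x] that by (simp add: G_def g'_def)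
  ultimately show ?thesis by blast
qed

text \<open>The points are placed one by one along an enumeration, using \<open>extension\<close>.
  Keeping \<open>\<psi> v\<close> near \<open>\<alpha> v\<close> transfers the block condition,
  stated for \<open>\<alpha>\<close>, to the points already placed by
  \<open>close_dd\<close>.\<close>

lemma countable_universality:
  fixes V :: "'v set" and \<alpha> :: "'v \<Rightarrow> 'c"
  assumes V: "countable V" and \<alpha>: "\<And>v. v \<in> V \<Longrightarrow> \<alpha> v \<in> mspace U"
    and D: "\<And>v v'. v \<in> V \<Longrightarrow> v' \<in> V \<Longrightarrow> D v v' \<in> S - {0} \<and> close (D v v') (dd (\<alpha> v) (\<alpha> v'))"
    and Dsym: "\<And>v v'. D v v' = D v' v"
  obtains \<psi> where "\<And>v. v \<in> V \<Longrightarrow> \<psi> v \<in> mspace U"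
    "\<And>v v'. v \<in> V \<Longrightarrow> v' \<in> V \<Longrightarrow> v \<noteq> v' \<Longrightarrow> d (\<psi> v) (\<psi> v') = D v v'"
proof -
  let ?n = "to_nat_on V"
  have inj: "inj_on ?n V" using V by (rule inj_on_to_nat_on)
  define P where "P f v y \<longleftrightarrow> (v \<in> V \<longrightarrow> y \<in> mspace U \<and> d (\<alpha> v) y \<le> 2 * s1 \<and>
    (\<forall>v'\<in>V. ?n v' < ?n v \<longrightarrow> d y (f v') = D v v'))" for f v y
  have "\<exists>f. \<forall>v. P f v (f v)"
  proof (rule dependent_wf_choice)
    show "wf (inv_image less_than ?n)" by (intro wf_inv_image wf_less_than)
    show "P f v y = P f' v y" if "\<And>z. (z, v) \<in> inv_image less_than ?n \<Longrightarrow> f z = f' z" for f f' v y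
      using that by (auto simp: P_def)
    fix v f assume IH: "\<And>v'. (v', v) \<in> inv_image less_than ?n \<Longrightarrow> P f v' (f v')"
    show "\<exists>y. P f v y"
    proof (cases "v \<in> V")
      case False then show ?thesis by (simp add: P_def)
    next
      case True
      define V' where "V' = {v' \<in> V. ?n v' < ?n v}"
      have "?n ` V' \<subseteq> {..<?n v}" by (auto simp: V'_def)
      then have "finite (?n ` V')" by (rule finite_subset) simp
      then have finV': "finite V'" by (rule finite_imageD) (use inj in \<open>auto simp: V'_def inj_on_def\<close>)
      have f: "f v' \<in> mspace U" "d (\<alpha> v') (f v') \<le> 2 * s1"
        "\<And>v''. v'' \<in> V \<Longrightarrow> ?n v'' < ?n v' \<Longrightarrow> d (f v') (f v'') = D v' v''" if "v' \<in> V'" for v'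
        using IH[of v'] that by (auto simp: P_def V'_def)
      have less: "f a \<noteq> f b" if "a \<in> V'" "b \<in> V'" "?n a < ?n b" for a b
        using f(3)[of b a] f(1)[of a] that D[of b a] by (auto simp: V'_def)
      have finj: "inj_on f V'"
      proof (rule inj_onI)
        fix a b assume ab: "a \<in> V'" "b \<in> V'" "f a = f b"
        then have "?n a = ?n b" using less[of a b] less[of b a] by (cases "?n a" "?n b" rule: linorder_cases) auto
        then show "a = b" using inj ab by (auto simp: V'_def inj_on_def)
      qed
      define g where "g x = D v (inv_into V' f x)" for x
      have gf: "g (f v') = D v v'" if "v' \<in> V'" for v' using that finj by (simp add: g_def)
      have "\<exists>y\<in>mspace U. d (\<alpha> v) y \<le> 2 * s1 \<and> (\<forall>x\<in>f ` V'. d y x = g x)"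
      proof (rule extension)
        show "finite (f ` V')" using finV' by simp
        show "f ` V' \<subseteq> mspace U" using f by auto
        show "\<alpha> v \<in> mspace U" using \<alpha> True by simp
        fix x assume "x \<in> f ` V'"
        then obtain v' where v': "v' \<in> V'" "x = f v'" by auto
        then have v'V: "v' \<in> V" by (simp add: V'_def)
        show "g x \<in> S - {0}" using v' gf D[OF True v'V] by simp
        have "close (dd (\<alpha> v) (\<alpha> v')) (dd (\<alpha> v) (f v'))"
          using \<alpha> True v'V f v' by (intro close_dd) auto
        then show "close (g x) (dd (\<alpha> v) x)"
          using close_trans[of "D v v'" "dd (\<alpha> v) (\<alpha> v')" "dd (\<alpha> v) (f v')"] D[OF True v'V] gf v'
            dd_S \<alpha> True v'V f by simp
      qed
      then show ?thesis using gf by (auto simp: P_def V'_def)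
    qed
  qed
  then obtain \<psi> where \<psi>: "\<And>v. P \<psi> v (\<psi> v)" by blast
  have "d (\<psi> v) (\<psi> v') = D v v'" if "v \<in> V" "v' \<in> V" "v \<noteq> v'" for v v'
  proof -
    have "?n v \<noteq> ?n v'" using inj that by (auto simp: inj_on_def)
    then show ?thesis
      using \<psi>[of v] \<psi>[of v'] that Dsym[of v v'] mdist_commute[of U "\<psi> v" "\<psi> v'"]
      unfolding P_def by (metis linorder_neqE_nat)
  qed
  moreover have "\<psi> v \<in> mspace U" if "v \<in> V" for v using \<psi>[of v] that by (simp add: P_def)
  ultimately show ?thesis using that by blast
qed

section \<open>Coding the limit by words and bounding the number of colours\<close>

lemma big_ramsey_degree_finite:
  fixes M :: "'a metric"
  assumes M: "finite (mspace M)" "mspace M \<noteq> {}"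
  shows "finite_big_ramsey_degree M U"
proof -
  obtain T where T: "T \<subseteq> mspace U" "finite T"
    and ex: "\<forall>x\<in>mspace U. \<exists>!t. t \<in> T \<and> d x t \<le> 2 * s1"
    using transversal by blast
  have "\<forall>x\<in>mspace U. \<exists>t. t \<in> T \<and> d x t \<le> 2 * s1" using ex by (meson ex1_implies_ex)
  then obtain rep where rep: "\<And>x. x \<in> mspace U \<Longrightarrow> rep x \<in> T"
    "\<And>x. x \<in> mspace U \<Longrightarrow> d x (rep x) \<le> 2 * s1" by (metis (no_types))
  have repU: "rep x \<in> mspace U" if "x \<in> mspace U" for x using rep(1)[OF that] T(1) by blast
  define r where "r = card S"
  have r: "0 < r" using finite_S zero_S by (auto simp: r_def card_gt_0_iff)
  obtain dec where dec: "bij_betw dec {..<r} S"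
    using ex_bij_betw_nat_finite[OF finite_S] by (auto simp: r_def atLeast0LessThan)
  define enc where "enc = inv_into {..<r} dec"
  have enc: "enc s < r" "dec (enc s) = s" if "s \<in> S" for s
    using dec that inv_into_into[of s dec "{..<r}"] f_inv_into_f[of s dec "{..<r}"]
    by (auto simp: bij_betw_def enc_def)

  \<comment> \<open>The points of the coding structure are pairs of a class representative and a word; the distance of
    two points is the letter of the longer word at the length of the shorter one.\<close>
  define letter :: "nat list \<Rightarrow> nat list \<Rightarrow> nat" where
    "letter y z = (if length y < length z then z ! length y
       else if length z < length y then y ! length z else 0)" for y z
  have letter_sym: "letter y z = letter z y" for y z by (simp add: letter_def)
  \<comment> \<open>A letter that does not name a distance in the right block is read as
    \<open>dd a b\<close>, so that \<open>D\<close> meets the block condition for arbitrary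
    words.\<close>
  define q where "q a b l = (if dec l \<in> S - {0} \<and> close (dec l) (dd a b) then dec l else dd a b)" for a b l
  define D where "D = (\<lambda>(a, y) (b, z). q a b (letter y z))"
  obtain \<psi> where \<psi>: "\<And>v. v \<in> T \<times> UNIV \<Longrightarrow> \<psi> v \<in> mspace U"
    "\<And>v v'. v \<in> T \<times> UNIV \<Longrightarrow> v' \<in> T \<times> UNIV \<Longrightarrow> v \<noteq> v' \<Longrightarrow> d (\<psi> v) (\<psi> v') = D v v'"
  proof (rule countable_universality[of "T \<times> UNIV" fst D])
    show "countable (T \<times> (UNIV :: nat list set))" using T(2) by (intro countable_SIGMA) (auto intro: countable_finite)
    show "fst v \<in> mspace U" if "v \<in> T \<times> UNIV" for v :: "'c \<times> nat list" using that T by auto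
    show "D v v' \<in> S - {0} \<and> close (D v v') (dd (fst v) (fst v'))"
      if "v \<in> T \<times> UNIV" "v' \<in> T \<times> UNIV" for v v'
    proof -
      obtain a y b z where v: "v = (a, y)" "v' = (b, z)" "a \<in> T" "b \<in> T" using \<open>v \<in> _\<close> \<open>v' \<in> _\<close> by auto
      then have "dd a b \<in> S - {0}" using T(1) by (intro dd_S) auto
      then show ?thesis using v close_refl by (auto simp: D_def q_def)
    qed
    show "D v v' = D v' v" for v v'
      by (auto simp: D_def q_def letter_sym dd_commute split: prod.splits)
  qed blast

  define idx where "idx = to_nat_on (mspace U)"
  have idx: "bij_betw idx (mspace U) UNIV"
    unfolding idx_def using limit U_Met by (intro to_nat_on_infinite) (auto simp: fraisse_limit_def Met_def)
  define u where "u = inv_into (mspace U) idx"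
  have u: "u (idx x) = x" if "x \<in> mspace U" for x
    using idx that by (simp add: u_def bij_betw_def)
  have uU: "u i \<in> mspace U" for i
    using idx inv_into_into[of i idx "mspace U"] by (simp add: u_def bij_betw_def)
  \<comment> \<open>The prefix provides the constants that \<open>envelope\<close> expects. With it,
    the length \<open>r + idx y\<close> of \<open>word y\<close> is the position at which
    \<open>word x\<close> records the distance to an earlier point \<open>y\<close>.\<close>
  define word where "word x = [0..<r] @ map (\<lambda>i. enc (d x (u i))) [0..<idx x]" for x
  have len: "length (word x) = r + idx x" for x by (simp add: word_def)
  have word: "set (word x) \<subseteq> {..<r}" "take r (word x) = [0..<r]" if "x \<in> mspace U" for x
    using enc(1)[OF d_S[OF that uU]] by (auto simp: word_def)
  have passing: "word x ! length (word y) = enc (d x y)"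
    if "x \<in> mspace U" "y \<in> mspace U" "idx y < idx x" for x y
    using that u[of y] by (simp add: len) (simp add: word_def nth_append)

  have isom: "d (\<psi> (rep x, reparam W (word x))) (\<psi> (rep y, reparam W (word y))) = d x y"
    if W: "rigid W" and x: "x \<in> mspace U" and y: "y \<in> mspace U" and lt: "idx y < idx x" for W x y
  proof -
    have xy: "x \<noteq> y" using lt by auto
    have occ: "first_occ W (length (word y)) < first_occ W (length (word x))"
      using lt by (intro first_occ_strict_mono W) (simp add: len)
    then have "reparam W (word x) \<noteq> reparam W (word y)" by (metis length_reparam less_irrefl)
    then have "d (\<psi> (rep x, reparam W (word x))) (\<psi> (rep y, reparam W (word y))) =
        q (rep x) (rep y) (letter (reparam W (word x)) (reparam W (word y)))"
      using \<psi>(2)[of "(rep x, reparam W (word x))" "(rep y, reparam W (word y))"] rep x y by (simp add: D_def)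
    also have "letter (reparam W (word x)) (reparam W (word y)) = enc (d x y)"
      using occ passing[OF x y lt] by (simp add: letter_def nth_reparam nth_first_occ W)
    also have "q (rep x) (rep y) (enc (d x y)) = d x y"
    proof -
      have dS: "d x y \<in> S - {0}" using d_S' x y xy by blast
      have "close (dd x y) (dd x (rep y))" using x y rep repU by (intro close_dd) auto
      moreover have "close (dd (rep y) x) (dd (rep y) (rep x))" using x y rep repU by (intro close_dd) auto
      ultimately have "close (dd x y) (dd (rep x) (rep y))"
        using close_trans[of "dd x y" "dd x (rep y)" "dd (rep x) (rep y)"] dd_S x y repU
          dd_commute[of "rep y"] by simp
      then show ?thesis using dS xy enc(2)[of "d x y"] by (simp add: q_def dd_def)
    qed
    finally show ?thesis .
  qed
  have emb: "(\<lambda>x\<in>mspace U. \<psi> (rep x, reparam W (word x))) \<in> embeddings U U" if W: "rigid W" for W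
  proof -
    have "d (\<psi> (rep x, reparam W (word x))) (\<psi> (rep y, reparam W (word y))) = d x y"
      if x: "x \<in> mspace U" and y: "y \<in> mspace U" for x y
    proof (cases "idx x" "idx y" rule: linorder_cases)
      case less then show ?thesis using isom[OF W y x] by (simp add: mdist_commute)
    next
      case equal
      then have "x = y" using u x y by metis
      then show ?thesis using \<psi>(1)[of "(rep x, reparam W (word x))"] rep x by simp
    next
      case greater then show ?thesis using isom[OF W x y] by simp
    qed
    then show ?thesis using \<psi>(1) rep by (auto simp: embeddings_def)
  qed

  define K where "K = Suc r ^ card (mspace M)"
  define Q where "Q k = (mspace M \<rightarrow>\<^sub>E T) \<times> (mspace M \<rightarrow>\<^sub>E {y. set y \<subseteq> {..<r} \<and> length y \<le> k})" for k :: nat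
  have finQ: "finite (Q k)" for k
    unfolding Q_def using M T(2) finite_lists_length_le[of "{..<r}" k] by (intro finite_cartesian_product finite_PiE) auto
  \<comment> \<open>The possible class assignments and patterns are counted over all
    \<open>k \<le> K\<close>, independently of the colouring; the successor ensures
    \<open>0 < t\<close>.\<close>
  define t where "t = Suc (card (SIGMA k:{..K}. Q k))"
  have "\<exists>w\<in>embeddings U U. card ((\<lambda>f. c (compose (mspace M) w f)) ` embeddings M U) \<le> t"
    if c: "c \<in> embeddings M U \<rightarrow> {..<n}" for n and c :: "('a \<Rightarrow> 'c) \<Rightarrow> nat"
  proof -
    \<comment> \<open>Not every word and pattern comes from an embedding, and elsewhere
      \<open>c\<close> is unrestricted; \<open>min n\<close> keeps the range finite and changes
      nothing on embeddings.\<close>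
    define \<kappa> where "\<kappa> k a = (\<lambda>(\<tau>, Y)\<in>Q k. min n (c (\<lambda>m\<in>mspace M. \<psi> (\<tau> m, inst_word a (Y m)))))" for k a
    have fin\<kappa>: "finite (range (\<kappa> k))" for k
    proof (rule finite_subset)
      show "range (\<kappa> k) \<subseteq> Q k \<rightarrow>\<^sub>E {..n}" by (auto simp: \<kappa>_def)
      show "finite (Q k \<rightarrow>\<^sub>E {..n})" by (intro finite_PiE finQ) simp
    qed
    from carlson_simpson_upto[of r \<kappa> K, OF r fin\<kappa>] obtain W \<gamma> where W: "rigid W"
      and hom: "\<forall>k\<le>K. r \<le> k \<longrightarrow> (\<forall>a\<in>growth_words r k. \<kappa> k (reparam W a) = \<gamma> k)" by (elim exE conjE)
    define w where "w = (\<lambda>x\<in>mspace U. \<psi> (rep x, reparam W (word x)))"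
    have w: "w \<in> embeddings U U" unfolding w_def by (rule emb[OF W])
    have "c (compose (mspace M) w f) \<in> (\<lambda>(k, p). \<gamma> k p) ` (SIGMA k:{..K}. Q k)"
      if f: "f \<in> embeddings M U" for f
    proof -
      have fU: "f m \<in> mspace U" if "m \<in> mspace M" for m using f that by (auto simp: embeddings_def)
      obtain k a Y where k: "r \<le> k" "k \<le> K" and a: "a \<in> growth_words r k"
        and Y: "Y \<in> mspace M \<rightarrow>\<^sub>E {y. set y \<subseteq> {..<r} \<and> length y \<le> k}"
        and X: "\<And>m. m \<in> mspace M \<Longrightarrow> word (f m) = inst_word a (Y m)"
        unfolding K_def by (rule envelope[OF M, of "\<lambda>m. word (f m)" r]) (use word fU in auto)
      define \<tau> where "\<tau> = (\<lambda>m\<in>mspace M. rep (f m))"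
      have \<tau>Y: "(\<tau>, Y) \<in> Q k" using Y rep fU by (auto simp: Q_def \<tau>_def)
      have "compose (mspace M) w f = (\<lambda>m\<in>mspace M. \<psi> (\<tau> m, inst_word (reparam W a) (Y m)))"
        using fU by (auto simp: compose_def w_def \<tau>_def X reparam_inst_word[OF W] intro!: restrict_ext)
      moreover have "compose (mspace M) w f \<in> embeddings M U"
        using w f fU by (auto simp: embeddings_def compose_def)
      then have "c (compose (mspace M) w f) = min n (c (compose (mspace M) w f))" using c by force
      ultimately have "c (compose (mspace M) w f) = \<kappa> k (reparam W a) (\<tau>, Y)"
        using \<tau>Y by (simp add: \<kappa>_def)
      also have "\<dots> = \<gamma> k (\<tau>, Y)" using hom k a by simp
      finally show ?thesis using k \<tau>Y by (intro image_eqI[of _ _ "(k, (\<tau>, Y))"]) auto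
    qed
    then have "(\<lambda>f. c (compose (mspace M) w f)) ` embeddings M U \<subseteq> (\<lambda>(k, p). \<gamma> k p) ` (SIGMA k:{..K}. Q k)"
      by blast
    then have "card ((\<lambda>f. c (compose (mspace M) w f)) ` embeddings M U) \<le> card (SIGMA k:{..K}. Q k)"
      by (rule surj_card_le[rotated]) (simp add: finQ)
    then have "card ((\<lambda>f. c (compose (mspace M) w f)) ` embeddings M U) \<le> t" by (simp add: t_def)
    then show ?thesis using w by (rule bexI)
  qed
  then show ?thesis unfolding finite_big_ramsey_degree_def by (intro exI[of _ t]) (simp add: t_def)
qed

end

theorem theorem5p9:
  fixes S :: "real set" and M :: "'a metric" and L :: "'b metric" and U :: "'c metric"
  assumes "compact_distance_set S" and "num_blocks S \<ge> 2"
    and "M \<in> Met S" and "finite (mspace M)"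
    and "L \<in> Met (S - block S 1)" and "finite (mspace L)"
    and "spans S L M"
    and "fraisse_limit S L U"
  shows "finite_big_ramsey_degree M U"
proof -
  interpret limit_space S U L
    using assms by unfold_locales (auto simp: fraisse_limit_def Met_spanned_def)
  \<comment> \<open>An envelope needs at least one word. An empty \<open>M\<close> would make
    \<open>L\<close> empty through \<open>spans\<close>, and then also the infinite space
    \<open>U\<close>.\<close>
  have "mspace M \<noteq> {}"
  proof
    assume "mspace M = {}"
    then have "mspace L = {}" using assms(6,7) by (simp add: spans_def quotient_def)
    then have "finite (mspace U // near S U)" "card (mspace U // near S U) = 0"
      using assms(8) by (auto simp: fraisse_limit_def Met_spanned_def spans_def)
    then have "mspace U = {}" by (auto simp: quotient_def)
    then show False using assms(8) by (simp add: fraisse_limit_def)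
  qed
  then show ?thesis by (rule big_ramsey_degree_finite[OF assms(4)])
qed

end
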